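(* Let $k\ge 1$, $n\ge 0$ be integers, let $M$ be a real-analytic manifold of dimension $k(n+1)$, and let $\{w(t)\}_{t\in\mathbb{R}\mathbb{P}^1}$ be a (real-analytic) generalized Veronese curve of distributions of codimension $k$ on $M$. Suppose there exist $n+3$ pairwise different points $a_0,\ldots,a_{n+2}\in\mathbb{R}\mathbb{P}^1$ such that each of the distributions $w(a_0),\ldots,w(a_{n+2})$ is integrable. Then $\{w(t)\}_{t\in\mathbb{R}\mathbb{P}^1}$ is a generalized Veronese web, i.e. $w(t)$ is integrable for every $t\in\mathbb{R}\mathbb{P}^1$.
   Context: All objects (manifolds, distributions, differential forms, functions) are real-analytic ($C^\omega$). $\mathbb{R}\mathbb{P}^1=\mathbb{R}\cup\{\infty\}$. A distribution is a subbundle of the real tangent bundle $TM$; it is integrable if it is integrable in the sense of Frobenius, i.e. its sections are closed under the Lie bracket. Generalized Veronese curve of distributions: let $M$ be a manifold of dimension $k(n+1)$ and let $\{w(t)\}_{t\in\mathbb{R}\mathbb{P}^1}$, $w(t)\subset TM$, be a family of distributions of codimension $k$ (so each $w(t)$ has rank $kn$). The family is called a generalized Veronese curve of distributions if in a neighbourhood of any point of $M$ there exist a coframe $\{\gamma_j^i : 1\le i\le k,\ 0\le j\le n\}$ (1-forms giving a basis of the cotangent space at each point of the neighbourhood) such that, setting $\gamma^i(t)=\gamma_0^i+t\gamma_1^i+\cdots+t^n\gamma_n^i$ for $t\in\mathbb{R}$ and $\gamma^i(\infty):=\gamma_n^i$, the 1-forms $\gamma^1(t),\ldots,\gamma^k(t)$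 are independent and annihilate $w(t)$ for every $t\in\mathbb{R}\mathbb{P}^1$ (hence $w(t)$ is the common kernel of $\gamma^1(t),\ldots,\gamma^k(t)$). A generalized Veronese curve of distributions is called integrable, or a generalized Veronese web, if $w(t)$ is integrable for each $t\in\mathbb{R}\mathbb{P}^1$, i.e. $d\gamma^i(t)=\sum_{s=1}^k\beta^i_s(t)\wedge\gamma^s(t)$, $1\le i\le k$, for some 1-forms $\beta^i_s(t)$ depending on $t$. *)

theory Defs
  imports "HOL-Analysis.Analysis" "HOL-Library.Function_Algebras"
begin

section \<open>Linear algebra in function spaces\<close>

text \<open>Tangent vectors and covectors are encoded below as functions; the pointwise vector space
  structure makes the library notions \<^const>\<open>span\<close> and \<^const>\<open>independent\<close> available for them.\<close>

instantiation "fun" :: (type, real_vector) real_vector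
begin

definition scaleR_fun :: "real \<Rightarrow> ('a \<Rightarrow> 'b) \<Rightarrow> 'a \<Rightarrow> 'b" where
  "scaleR_fun r f = (\<lambda>x. r *\<^sub>R f x)"

instance
  by standard (auto simp: scaleR_fun_def plus_fun_def scaleR_right_distrib scaleR_left_distrib)

end

definition independent_family :: "'i set \<Rightarrow> ('i \<Rightarrow> 'v::real_vector) \<Rightarrow> bool" where
  "independent_family I f \<longleftrightarrow> inj_on f I \<and> independent (f ` I)"

definition basis_family :: "'i set \<Rightarrow> ('i \<Rightarrow> 'v::real_vector) \<Rightarrow> 'v set \<Rightarrow> bool" where
  "basis_family I f V \<longleftrightarrow> independent_family I f \<and> span (f ` I) = V"


section \<open>Real-analytic functions of several variables\<close>

text \<open>Multi-indices are the extensional functions from the standard basis to the naturals. The sum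
  is unconditional, which in finite dimension means absolutely convergent.\<close>

definition real_analytic_on ::
    "('e::euclidean_space \<Rightarrow> 'f::euclidean_space) \<Rightarrow> 'e set \<Rightarrow> bool" where
  "real_analytic_on f S \<longleftrightarrow>
     (\<forall>x\<in>S. \<exists>(a :: ('e \<Rightarrow> nat) \<Rightarrow> 'f) r. r > 0 \<and>
        (\<forall>y. (\<forall>b\<in>Basis. \<bar>(y - x) \<bullet> b\<bar> < r) \<longrightarrow>
           ((\<lambda>\<alpha>. (\<Prod>b\<in>Basis. ((y - x) \<bullet> b) ^ \<alpha> b) *\<^sub>R a \<alpha>) has_sum f y)
             (Basis \<rightarrow>\<^sub>E UNIV)))"


section \<open>Real-analytic manifolds\<close>

text \<open>A chart is a pair of its domain and its coordinate map; the values of the map outside the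
  domain are irrelevant. The dimension of the manifold is that of the model space \<^typ>\<open>'e\<close>.\<close>

type_synonym ('m, 'e) chart = "'m set \<times> ('m \<Rightarrow> 'e)"

definition is_chart :: "'m topology \<Rightarrow> ('m, 'e::euclidean_space) chart \<Rightarrow> bool" where
  "is_chart X c \<longleftrightarrow>
     openin X (fst c) \<and> open (snd c ` fst c) \<and>
     homeomorphic_map (subtopology X (fst c)) (top_of_set (snd c ` fst c)) (snd c)"

definition chart_inv :: "('m, 'e) chart \<Rightarrow> 'e \<Rightarrow> 'm" where
  "chart_inv c = inv_into (fst c) (snd c)"

definition transition :: "('m, 'e) chart \<Rightarrow> ('m, 'e) chart \<Rightarrow> 'e \<Rightarrow> 'e" where
  "transition c d = snd d \<circ> chart_inv c"

definition analytic_manifold ::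
    "'m topology \<Rightarrow> ('m, 'e::euclidean_space) chart set \<Rightarrow> bool" where
  "analytic_manifold X A \<longleftrightarrow>
     Hausdorff_space X \<and> second_countable X \<and>
     (\<forall>c\<in>A. is_chart X c) \<and> (\<Union>c\<in>A. fst c) = topspace X \<and>
     (\<forall>c\<in>A. \<forall>d\<in>A. real_analytic_on (transition c d) (snd c ` (fst c \<inter> fst d)))"


section \<open>Tangent and cotangent spaces\<close>

text \<open>A tangent vector at \<open>p\<close> is the family of its coordinate vectors in all charts of the atlas
  around \<open>p\<close>, related by the derivatives of the transition maps. It is set to \<open>0\<close> at all other pairs
  so that it is determined by these coordinate vectors.\<close>

type_synonym ('m, 'e) tvec = "('m, 'e) chart \<Rightarrow> 'e"

definition tangent_space ::
    "('m, 'e::euclidean_space) chart set \<Rightarrow> 'm \<Rightarrow> ('m, 'e) tvec set" where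
  "tangent_space A p = {v.
     (\<forall>c\<in>A. \<forall>d\<in>A. p \<in> fst c \<longrightarrow> p \<in> fst d \<longrightarrow>
        v d = frechet_derivative (transition c d) (at (snd c p)) (v c)) \<and>
     (\<forall>c. \<not> (c \<in> A \<and> p \<in> fst c) \<longrightarrow> v c = 0)}"

text \<open>The tangent vector at \<open>p\<close> whose coordinate vector in the chart \<open>c\<close> is \<open>e\<close>.\<close>

definition coord_vector ::
    "('m, 'e::euclidean_space) chart set \<Rightarrow> ('m, 'e) chart \<Rightarrow> 'm \<Rightarrow> 'e \<Rightarrow> ('m, 'e) tvec" where
  "coord_vector A c p e =
     (\<lambda>d. if d \<in> A \<and> p \<in> fst d
          then frechet_derivative (transition c d) (at (snd c p)) e else 0)"

text \<open>Covectors at \<open>p\<close> are the linear functionals on the tangent space at \<open>p\<close>, extended by \<open>0\<close>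
  outside of it.\<close>

definition cotangent_space ::
    "('m, 'e::euclidean_space) chart set \<Rightarrow> 'm \<Rightarrow> (('m, 'e) tvec \<Rightarrow> real) set" where
  "cotangent_space A p = {\<omega>.
     (\<forall>u\<in>tangent_space A p. \<forall>v\<in>tangent_space A p. \<omega> (u + v) = \<omega> u + \<omega> v) \<and>
     (\<forall>r. \<forall>v\<in>tangent_space A p. \<omega> (r *\<^sub>R v) = r * \<omega> v) \<and>
     (\<forall>v. v \<notin> tangent_space A p \<longrightarrow> \<omega> v = 0)}"


section \<open>Analytic vector fields, 1-forms and the Lie bracket\<close>

definition vector_field_in_chart ::
    "('m, 'e) chart \<Rightarrow> ('m \<Rightarrow> ('m, 'e) tvec) \<Rightarrow> 'e \<Rightarrow> 'e" where
  "vector_field_in_chart c Y = (\<lambda>x. Y (chart_inv c x) c)"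

definition analytic_vector_field ::
    "('m, 'e::euclidean_space) chart set \<Rightarrow> 'm set \<Rightarrow> ('m \<Rightarrow> ('m, 'e) tvec) \<Rightarrow> bool" where
  "analytic_vector_field A U Y \<longleftrightarrow>
     (\<forall>p\<in>U. Y p \<in> tangent_space A p) \<and>
     (\<forall>c\<in>A. real_analytic_on (vector_field_in_chart c Y) (snd c ` (U \<inter> fst c)))"

definition analytic_one_form ::
    "('m, 'e::euclidean_space) chart set \<Rightarrow> 'm set \<Rightarrow> ('m \<Rightarrow> ('m, 'e) tvec \<Rightarrow> real) \<Rightarrow> bool" where
  "analytic_one_form A U \<omega> \<longleftrightarrow>
     (\<forall>p\<in>U. \<omega> p \<in> cotangent_space A p) \<and>
     (\<forall>c\<in>A. \<forall>b\<in>Basis.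
        real_analytic_on (\<lambda>x. \<omega> (chart_inv c x) (coord_vector A c (chart_inv c x) b))
          (snd c ` (U \<inter> fst c)))"

definition lie_bracket ::
    "('m, 'e::euclidean_space) chart set \<Rightarrow> ('m \<Rightarrow> ('m, 'e) tvec) \<Rightarrow> ('m \<Rightarrow> ('m, 'e) tvec) \<Rightarrow>
     'm \<Rightarrow> ('m, 'e) tvec" where
  "lie_bracket A Y Z p =
     (\<lambda>c. if c \<in> A \<and> p \<in> fst c
          then frechet_derivative (vector_field_in_chart c Z) (at (snd c p)) (Y p c) -
               frechet_derivative (vector_field_in_chart c Y) (at (snd c p)) (Z p c)
          else 0)"


section \<open>Distributions\<close>

definition analytic_distribution ::
    "'m topology \<Rightarrow> ('m, 'e::euclidean_space) chart set \<Rightarrow> nat \<Rightarrow>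
     ('m \<Rightarrow> ('m, 'e) tvec set) \<Rightarrow> bool" where
  "analytic_distribution X A r D \<longleftrightarrow>
     (\<forall>p\<in>topspace X. \<exists>U F. openin X U \<and> p \<in> U \<and>
        (\<forall>i\<in>{1..r}. analytic_vector_field A U (F i)) \<and>
        (\<forall>q\<in>U. basis_family {1..r} (\<lambda>i. F i q) (D q)))"

definition section_on ::
    "('m, 'e::euclidean_space) chart set \<Rightarrow> 'm set \<Rightarrow> ('m \<Rightarrow> ('m, 'e) tvec set) \<Rightarrow>
     ('m \<Rightarrow> ('m, 'e) tvec) \<Rightarrow> bool" where
  "section_on A U D Y \<longleftrightarrow> analytic_vector_field A U Y \<and> (\<forall>p\<in>U. Y p \<in> D p)"

definition integrable_distribution ::
    "'m topology \<Rightarrow> ('m, 'e::euclidean_space) chart set \<Rightarrow> ('m \<Rightarrow> ('m, 'e) tvec set) \<Rightarrow> bool" where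
  "integrable_distribution X A D \<longleftrightarrow>
     (\<forall>U Y Z. openin X U \<longrightarrow> section_on A U D Y \<longrightarrow> section_on A U D Z \<longrightarrow>
        section_on A U D (lie_bracket A Y Z))"


section \<open>Generalized Veronese curves and webs\<close>

datatype rp1 = Fin real | Infty

text \<open>The covector of the \<open>i\<close>-th form of the curve, from the covectors \<open>g i j\<close> of a coframe.\<close>

definition veronese_form :: "nat \<Rightarrow> (nat \<Rightarrow> nat \<Rightarrow> 'v::real_vector) \<Rightarrow> rp1 \<Rightarrow> nat \<Rightarrow> 'v" where
  "veronese_form n g t i = (case t of Fin s \<Rightarrow> (\<Sum>j=0..n. s ^ j *\<^sub>R g i j) | Infty \<Rightarrow> g i n)"

definition generalized_veronese_curve ::
    "'m topology \<Rightarrow> ('m, 'e::euclidean_space) chart set \<Rightarrow> nat \<Rightarrow> nat \<Rightarrow>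
     (rp1 \<Rightarrow> 'm \<Rightarrow> ('m, 'e) tvec set) \<Rightarrow> bool" where
  "generalized_veronese_curve X A k n w \<longleftrightarrow>
     (\<forall>t. analytic_distribution X A (k * n) (w t)) \<and>
     (\<forall>p\<in>topspace X. \<exists>U \<gamma>. openin X U \<and> p \<in> U \<and>
        (\<forall>i\<in>{1..k}. \<forall>j\<in>{0..n}. analytic_one_form A U (\<gamma> i j)) \<and>
        (\<forall>q\<in>U. basis_family ({1..k} \<times> {0..n}) (\<lambda>(i, j). \<gamma> i j q) (cotangent_space A q)) \<and>
        (\<forall>q\<in>U. \<forall>t.
           independent_family {1..k} (veronese_form n (\<lambda>i j. \<gamma> i j q) t) \<and>
           (\<forall>i\<in>{1..k}. \<forall>v\<in>w t q. veronese_form n (\<lambda>i j. \<gamma> i j q) t i v = 0)))"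

definition generalized_veronese_web ::
    "'m topology \<Rightarrow> ('m, 'e::euclidean_space) chart set \<Rightarrow> nat \<Rightarrow> nat \<Rightarrow>
     (rp1 \<Rightarrow> 'm \<Rightarrow> ('m, 'e) tvec set) \<Rightarrow> bool" where
  "generalized_veronese_web X A k n w \<longleftrightarrow>
     generalized_veronese_curve X A k n w \<and> (\<forall>t. integrable_distribution X A (w t))"

end

theory Submission
  imports Defs
begin

text \<open>
  Integrability is a pointwise algebraic condition. Let \<open>\<theta>\<close> be a 1-form and \<open>Y\<close>, \<open>Z\<close> vector fields that
  it annihilates. Then \<open>\<theta>([Y, Z]) = - d\<theta>(Y, Z)\<close> by Cartan's formula (\<open>form_lie_bracket\<close>), and the
  right-hand side at a point depends only on the values of \<open>Y\<close> and \<open>Z\<close> there. Since \<open>w(t)\<close> is exactly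
  the common kernel of \<open>\<gamma>\<^sup>1(t), \<dots>, \<gamma>\<^sup>k(t)\<close> (\<open>distribution_eq_common_kernel\<close>, a dimension count) and each
  of its vectors extends to a section, \<open>w(t)\<close> is integrable if and only if at every point the bilinear
  forms \<open>d\<gamma>\<^sup>i(t)\<close> vanish on \<open>w(t)\<close>.

  At a fixed point let \<open>E\<^sub>i\<^sub>j\<close> be the basis dual to the coframe. For finite \<open>t\<close> the kernel \<open>w(t)\<close> is spanned
  by the vectors \<open>t E\<^sub>i\<^sub>j - E\<^sub>i\<^sub>,\<^sub>j\<^sub>+\<^sub>1\<close> with \<open>j < n\<close>, and \<open>w(\<infinity>)\<close> by the \<open>E\<^sub>i\<^sub>j\<close> with \<open>j < n\<close>, their leading
  coefficients. The form \<open>d\<gamma>\<^sup>i(t)\<close> is a polynomial in \<open>t\<close> of degree \<open>n\<close>, so its value on two spanning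
  vectors is a polynomial of degree at most \<open>n + 2\<close>, and its coefficient of degree \<open>n + 2\<close> is the value of
  \<open>d\<gamma>\<^sup>i(\<infinity>)\<close> on the leading coefficients. Integrability at \<open>n + 3\<close> points of the projective line
  provides more roots, \<open>\<infinity>\<close> included, than a nonzero polynomial of this degree can have
  (\<open>veronese_vanishing\<close>).

  What remains is the calculus behind the word section: the bracket of analytic vector fields has
  to be an analytic vector field. Analyticity needs products and derivatives of power series in
  several variables; compatibility with the change of charts needs the symmetry of second
  derivatives, which is also read off from power series.
\<close>

section \<open>Power series in several variables\<close>

text \<open>The open ball of the maximum norm: the shape of the domains on which power series in several
  variables are required to converge.\<close>
definition cube :: "'e::euclidean_space \<Rightarrow> real \<Rightarrow> 'e set" where
  "cube x r = {y. \<forall>b\<in>Basis. \<bar>(y - x) \<bullet> b\<bar> < r}"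

definition monomial :: "('e::euclidean_space \<Rightarrow> nat) \<Rightarrow> 'e \<Rightarrow> real" where
  "monomial \<alpha> h = (\<Prod>b\<in>Basis. (h \<bullet> b) ^ \<alpha> b)"

text \<open>A power series is listed as a sequence of monomials in which an exponent may occur any number of
  times. With this freedom the product of two series and the term by term derivative of a series
  are such lists without any collection of like terms; that is done once and for all in
  \<open>expands_regroup\<close>.\<close>
definition expands_on_cube ::
    "('e::euclidean_space \<Rightarrow> 'f::euclidean_space) \<Rightarrow> 'e \<Rightarrow> real \<Rightarrow> (nat \<Rightarrow> 'e \<Rightarrow> nat) \<Rightarrow> (nat \<Rightarrow> 'f) \<Rightarrow> bool"
  where
  "expands_on_cube f x r \<alpha> c \<longleftrightarrow>
     (\<forall>y\<in>cube x r. ((\<lambda>i. monomial (\<alpha> i) (y - x) *\<^sub>R c i) has_sum f y) UNIV)"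

lemma centre_in_cube: "r > 0 \<Longrightarrow> x \<in> cube x r"
  by (simp add: cube_def)

lemma cube_mono: "r \<le> s \<Longrightarrow> cube x r \<subseteq> cube x s"
  by (auto simp: cube_def intro: less_le_trans)

lemma cube_eq_INT: "cube x r = (\<Inter>b\<in>Basis. {y. (y - x) \<bullet> b \<in> {-r<..<r}})"
  by (auto simp: cube_def abs_less_iff minus_less_iff)

lemma open_cube: "open (cube x r)"
  unfolding cube_eq_INT
  by (intro open_INT ballI finite_Basis)
     (auto intro!: open_Collect_conj open_Collect_less continuous_intros simp: greaterThanLessThan_iff)

lemma convex_cube: "convex (cube x r)"
  unfolding cube_eq_INT
proof (intro convex_INT)
  fix b :: 'a
  have "{y. (y - x) \<bullet> b \<in> {-r<..<r}} = {y. b \<bullet> y > b \<bullet> x - r} \<inter> {y. b \<bullet> y < b \<bullet> x + r}"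
    by (auto simp: inner_diff_right inner_diff_left inner_commute[of _ b])
  then show "convex {y. (y - x) \<bullet> b \<in> {-r<..<r}}"
    by (simp add: convex_Int convex_halfspace_gt convex_halfspace_lt)
qed

lemma cube_within_open:
  fixes x :: "'e::euclidean_space"
  assumes "open S" "x \<in> S"
  obtains r where "r > 0" "cube x r \<subseteq> S"
proof -
  obtain e where e: "e > 0" "ball x e \<subseteq> S"
    using assms openE by blast
  define r where "r = e / DIM('e)"
  have "cube x r \<subseteq> ball x e"
  proof
    fix y assume y: "y \<in> cube x r"
    have "norm (y - x) \<le> (\<Sum>b\<in>Basis. \<bar>(y - x) \<bullet> b\<bar>)"
      by (rule norm_le_l1)
    also have "\<dots> < (\<Sum>b\<in>(Basis::'e set). r)"
      by (rule sum_strict_mono) (use y in \<open>auto simp: cube_def\<close>)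
    also have "\<dots> = e"
      by (simp add: r_def)
    finally show "y \<in> ball x e"
      by (simp add: dist_norm norm_minus_commute)
  qed
  moreover have "r > 0"
    using e by (simp add: r_def)
  ultimately show ?thesis
    using e that by blast
qed

text \<open>An unconditionally convergent real series converges absolutely; in finite dimension this applies to
  each coordinate.\<close>
lemma has_sum_imp_summable_norm:
  fixes u :: "nat \<Rightarrow> 'f::euclidean_space"
  assumes "(u has_sum s) UNIV"
  shows "summable (\<lambda>i. norm (u i))"
proof (rule summable_comparison_test')
  have "summable (\<lambda>i. \<bar>u i \<bullet> b\<bar>)" for b
  proof -
    have "((\<lambda>i. u i \<bullet> b) has_sum s \<bullet> b) UNIV"
      using has_sum_bounded_linear[OF bounded_linear_inner_left assms] .
    then have "(\<lambda>i. norm (u i \<bullet> b)) summable_on UNIV"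
      unfolding summable_on_iff_abs_summable_on_real[symmetric] by (rule has_sum_imp_summable)
    then show ?thesis
      by (simp add: summable_on_imp_summable)
  qed
  then show "summable (\<lambda>i. \<Sum>b\<in>Basis. \<bar>u i \<bullet> b\<bar>)"
    by (intro summable_sum) auto
  show "norm (norm (u i)) \<le> (\<Sum>b\<in>Basis. \<bar>u i \<bullet> b\<bar>)" for i
    using norm_le_l1[of "u i"] by simp
qed

lemma monomial_cong: "(\<And>b. b \<in> Basis \<Longrightarrow> \<alpha> b = \<beta> b) \<Longrightarrow> monomial \<alpha> h = monomial \<beta> h"
  by (simp add: monomial_def)

lemma monomial_add: "monomial (\<lambda>b. \<alpha> b + \<beta> b) h = monomial \<alpha> h * monomial \<beta> h"
  by (simp add: monomial_def power_add prod.distrib)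

lemma monomial_scaled_One: "monomial \<alpha> (s *\<^sub>R One) = (\<Prod>b\<in>Basis. s ^ \<alpha> b)"
  by (simp add: monomial_def)

text \<open>Like terms are collected by summing the coefficients over the fibre of each exponent. The
  coefficients are summable there, because at an interior point of the cube with all coordinates
  nonzero the series differs on the fibre from that of the coefficients by one nonzero factor.\<close>
lemma expands_regroup:
  fixes f :: "'e::euclidean_space \<Rightarrow> 'f::euclidean_space"
  assumes "expands_on_cube f x r \<alpha> c" "r > 0"
  shows "\<exists>a. \<forall>y\<in>cube x r. ((\<lambda>\<beta>. monomial \<beta> (y - x) *\<^sub>R a \<beta>) has_sum f y) (Basis \<rightarrow>\<^sub>E UNIV)"
proof -
  define B where "B i = restrict (\<alpha> i) Basis" for i
  define I where "I \<beta> = {i. B i = \<beta>}" for \<beta>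
  have mB: "monomial (\<alpha> i) h = monomial (B i) h" for i h
    by (rule monomial_cong) (simp add: B_def)
  have c: "c summable_on I \<beta>" for \<beta>
  proof -
    define y where "y = x + (r / 2) *\<^sub>R One"
    have "y \<in> cube x r"
      using assms(2) by (simp add: cube_def y_def)
    then have "(\<lambda>i. monomial (B i) (y - x) *\<^sub>R c i) summable_on UNIV"
      using assms(1) has_sum_imp_summable by (auto simp: expands_on_cube_def mB)
    then have "(\<lambda>i. monomial (B i) (y - x) *\<^sub>R c i) summable_on I \<beta>"
      by (rule summable_on_subset_banach) simp
    then have "(\<lambda>i. monomial \<beta> (y - x) *\<^sub>R c i) summable_on I \<beta>"
      by (rule summable_on_cong[THEN iffD1, rotated]) (simp add: I_def)
    then have "(\<lambda>i. inverse (monomial \<beta> (y - x)) *\<^sub>R monomial \<beta> (y - x) *\<^sub>R c i) summable_on I \<beta>"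
      by (rule summable_on_bounded_linear[OF bounded_linear_scaleR_right])
    moreover have "monomial \<beta> (y - x) \<noteq> 0"
      using assms(2) by (simp add: y_def monomial_scaled_One[of \<beta> "r / 2", simplified])
    ultimately show ?thesis
      by simp
  qed
  have "((\<lambda>\<beta>. monomial \<beta> (y - x) *\<^sub>R infsum c (I \<beta>)) has_sum f y) (Basis \<rightarrow>\<^sub>E UNIV)"
    if "y \<in> cube x r" for y
  proof (rule has_sum_SigmaD)
    have "bij_betw (\<lambda>i. (B i, i)) UNIV (Sigma (Basis \<rightarrow>\<^sub>E UNIV) I)"
      by (auto simp: bij_betw_def inj_on_def I_def B_def)
    from has_sum_reindex_bij_betw[OF this, of "\<lambda>(\<beta>, i). monomial \<beta> (y - x) *\<^sub>R c i" "f y"]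
    show "((\<lambda>(\<beta>, i). monomial \<beta> (y - x) *\<^sub>R c i) has_sum f y) (Sigma (Basis \<rightarrow>\<^sub>E UNIV) I)"
      using assms(1) that by (simp add: expands_on_cube_def mB)
  next
    fix \<beta> :: "'e \<Rightarrow> nat"
    show "((\<lambda>i. case (\<beta>, i) of (\<beta>, i) \<Rightarrow> monomial \<beta> (y - x) *\<^sub>R c i) has_sum
        monomial \<beta> (y - x) *\<^sub>R infsum c (I \<beta>)) (I \<beta>)"
      using has_sum_bounded_linear[OF bounded_linear_scaleR_right has_sum_infsum[OF c]] by simp
  qed
  then show ?thesis
    by (intro exI[of _ "\<lambda>\<beta>. infsum c (I \<beta>)"]) blast
qed

lemma real_analytic_on_iff_expands:
  fixes f :: "'e::euclidean_space \<Rightarrow> 'f::euclidean_space"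
  shows "real_analytic_on f S \<longleftrightarrow> (\<forall>x\<in>S. \<exists>r \<alpha> c. r > 0 \<and> expands_on_cube f x r \<alpha> c)"
proof (intro iffI ballI)
  fix x assume "real_analytic_on f S" "x \<in> S"
  then obtain a r where r: "r > 0"
    and a: "\<And>y. y \<in> cube x r \<Longrightarrow>
      ((\<lambda>\<beta>. monomial \<beta> (y - x) *\<^sub>R a \<beta>) has_sum f y) (Basis \<rightarrow>\<^sub>E UNIV)"
    unfolding real_analytic_on_def monomial_def cube_def by blast
  have "infinite ((Basis :: 'e set) \<rightarrow>\<^sub>E (UNIV :: nat set))"
    by (auto simp: finite_PiE_iff)
  moreover have "countable ((Basis :: 'e set) \<rightarrow>\<^sub>E (UNIV :: nat set))"
    by (intro countable_PiE) auto
  ultimately obtain \<alpha> where \<alpha>: "bij_betw \<alpha> (UNIV :: nat set) ((Basis :: 'e set) \<rightarrow>\<^sub>E (UNIV :: nat set))"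
    using bij_betw_from_nat_into by blast
  have "expands_on_cube f x r \<alpha> (\<lambda>i. a (\<alpha> i))"
    unfolding expands_on_cube_def
    using has_sum_reindex_bij_betw[OF \<alpha>, of "\<lambda>\<beta>. monomial \<beta> (y - x) *\<^sub>R a \<beta>" for y] a by simp
  with r show "\<exists>r \<alpha> c. r > 0 \<and> expands_on_cube f x r \<alpha> c"
    by blast
next
  assume *: "\<forall>x\<in>S. \<exists>r \<alpha> c. r > 0 \<and> expands_on_cube f x r \<alpha> c"
  then show "real_analytic_on f S"
    unfolding real_analytic_on_def
  proof (intro ballI)
    fix x assume "x \<in> S"
    then obtain r \<alpha> c where "r > 0" "expands_on_cube f x r \<alpha> c"
      using * by blast
    with expands_regroup obtain a where "r > 0"
      "\<forall>y\<in>cube x r. ((\<lambda>\<beta>. monomial \<beta> (y - x) *\<^sub>R a \<beta>) has_sum f y) (Basis \<rightarrow>\<^sub>E UNIV)"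
      by blast
    then show "\<exists>a r. r > 0 \<and> (\<forall>y. (\<forall>b\<in>Basis. \<bar>(y - x) \<bullet> b\<bar> < r) \<longrightarrow>
        ((\<lambda>\<alpha>. (\<Prod>b\<in>Basis. ((y - x) \<bullet> b) ^ \<alpha> b) *\<^sub>R a \<alpha>) has_sum f y) (Basis \<rightarrow>\<^sub>E UNIV))"
      by (intro exI[of _ a] exI[of _ r]) (simp add: cube_def monomial_def)
  qed
qed

lemma expands_mono: "expands_on_cube f x r \<alpha> c \<Longrightarrow> s \<le> r \<Longrightarrow> expands_on_cube f x s \<alpha> c"
  using cube_mono by (fastforce simp: expands_on_cube_def)

lemma has_derivative_monomial:
  fixes h :: "'e::euclidean_space"
  shows "(monomial \<alpha> has_derivative
    (\<lambda>k. \<Sum>b\<in>Basis. (k \<bullet> b) * (real (\<alpha> b) * monomial (\<alpha>(b := \<alpha> b - 1)) h))) (at h within S)"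
proof -
  have *: "monomial (\<alpha>(b := \<alpha> b - 1)) h = (h \<bullet> b) ^ (\<alpha> b - 1) * (\<Prod>d\<in>Basis - {b}. (h \<bullet> d) ^ \<alpha> d)"
    if "b \<in> Basis" for b
    unfolding monomial_def prod.remove[OF finite_Basis that] by simp
  have "((\<lambda>h. \<Prod>b\<in>Basis. (h \<bullet> b) ^ \<alpha> b) has_derivative
      (\<lambda>k. \<Sum>b\<in>Basis. (real (\<alpha> b) * (k \<bullet> b) * (h \<bullet> b) ^ (\<alpha> b - 1)) *
        (\<Prod>d\<in>Basis - {b}. (h \<bullet> d) ^ \<alpha> d))) (at h within S)"
    by (rule has_derivative_prod) (auto intro!: derivative_eq_intros)
  moreover have "monomial \<alpha> = (\<lambda>h. \<Prod>b\<in>Basis. (h \<bullet> b) ^ \<alpha> b)"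
    by (simp add: monomial_def fun_eq_iff)
  moreover have "(\<lambda>k. \<Sum>b\<in>Basis. (k \<bullet> b) * (real (\<alpha> b) * monomial (\<alpha>(b := \<alpha> b - 1)) h)) =
      (\<lambda>k. \<Sum>b\<in>Basis. (real (\<alpha> b) * (k \<bullet> b) * (h \<bullet> b) ^ (\<alpha> b - 1)) *
        (\<Prod>d\<in>Basis - {b}. (h \<bullet> d) ^ \<alpha> d))"
    by (intro ext sum.cong refl) (simp only: * mult_ac)
  ultimately show ?thesis
    by simp
qed

text \<open>One term of the binomial expansion of the right-hand side. It bounds the exponent that
  differentiation brings down at the price of a slightly larger radius.\<close>
lemma mult_power_pred_le:
  fixes \<rho> \<delta> :: real
  assumes "\<rho> \<ge> 0" "\<delta> \<ge> 0"
  shows "real m * \<rho> ^ (m - 1) * \<delta> \<le> (\<rho> + \<delta>) ^ m"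
proof (induction m)
  case (Suc m)
  have "real (Suc m) * \<rho> ^ (Suc m - 1) * \<delta> = \<rho> * (real m * \<rho> ^ (m - 1) * \<delta>) + \<delta> * \<rho> ^ m"
    by (cases m) (simp_all add: algebra_simps)
  also have "\<dots> \<le> \<rho> * (\<rho> + \<delta>) ^ m + \<delta> * (\<rho> + \<delta>) ^ m"
    using assms Suc by (intro add_mono mult_left_mono power_mono) auto
  finally show ?case
    by (simp add: algebra_simps)
qed auto

text \<open>The majorant for termwise partial derivatives: up to the constant factor \<open>1 / \<delta>\<close> it is the
  monomial itself at the corner of a slightly larger cube. A power series that converges there
  thus dominates its differentiated series on the smaller cube.\<close>
lemma monomial_derivative_bound:
  fixes h :: "'e::euclidean_space"
  assumes "h \<in> cube 0 \<rho>" "0 \<le> \<rho>" "0 < \<delta>" "b \<in> Basis"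
  shows "\<bar>real (\<alpha> b) * monomial (\<alpha>(b := \<alpha> b - 1)) h\<bar> \<le> monomial \<alpha> ((\<rho> + \<delta>) *\<^sub>R One) / \<delta>"
proof -
  have h: "\<bar>h \<bullet> d\<bar> \<le> \<rho>" if "d \<in> Basis" for d
    using assms(1) that by (auto simp: cube_def intro: less_imp_le)
  have "\<bar>real (\<alpha> b) * monomial (\<alpha>(b := \<alpha> b - 1)) h\<bar>
      = (real (\<alpha> b) * \<bar>h \<bullet> b\<bar> ^ (\<alpha> b - 1)) * (\<Prod>d\<in>Basis - {b}. \<bar>h \<bullet> d\<bar> ^ \<alpha> d)"
    unfolding monomial_def prod.remove[OF finite_Basis assms(4)]
    by (simp add: abs_mult abs_prod power_abs)
  also have "\<dots> \<le> ((\<rho> + \<delta>) ^ \<alpha> b / \<delta>) * (\<Prod>d\<in>Basis - {b}. (\<rho> + \<delta>) ^ \<alpha> d)"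
  proof (intro mult_mono prod_mono conjI)
    have "real (\<alpha> b) * \<bar>h \<bullet> b\<bar> ^ (\<alpha> b - 1) * \<delta> \<le> (\<bar>h \<bullet> b\<bar> + \<delta>) ^ \<alpha> b"
      using assms by (intro mult_power_pred_le) auto
    also have "\<dots> \<le> (\<rho> + \<delta>) ^ \<alpha> b"
      using h[OF assms(4)] assms by (intro power_mono) auto
    finally show "real (\<alpha> b) * \<bar>h \<bullet> b\<bar> ^ (\<alpha> b - 1) \<le> (\<rho> + \<delta>) ^ \<alpha> b / \<delta>"
      using assms by (simp add: field_simps)
    show "\<bar>h \<bullet> d\<bar> ^ \<alpha> d \<le> (\<rho> + \<delta>) ^ \<alpha> d" if "d \<in> Basis - {b}" for d
      using h[of d] that assms by (intro power_mono) auto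
  qed (use assms in \<open>auto intro!: prod_nonneg\<close>)
  also have "\<dots> = monomial \<alpha> ((\<rho> + \<delta>) *\<^sub>R One) / \<delta>"
    unfolding monomial_scaled_One prod.remove[OF finite_Basis assms(4)] by simp
  finally show ?thesis .
qed

text \<open>Uniform estimates hold only on smaller cubes, so a point is first placed in one of them.\<close>
lemma cube_shrink:
  fixes x y :: "'e::euclidean_space"
  assumes "y \<in> cube x r"
  obtains \<rho> where "0 < \<rho>" "\<rho> < r" "y \<in> cube x \<rho>"
proof -
  define m where "m = Max ((\<lambda>b. \<bar>(y - x) \<bullet> b\<bar>) ` Basis)"
  have m: "\<bar>(y - x) \<bullet> b\<bar> \<le> m" if "b \<in> Basis" for b
    unfolding m_def using that by (intro Max_ge) auto
  have "m \<in> (\<lambda>b. \<bar>(y - x) \<bullet> b\<bar>) ` Basis"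
    unfolding m_def by (intro Max_in) auto
  then have "0 \<le> m" "m < r"
    using assms by (auto simp: cube_def)
  then have "0 < (m + r) / 2" "(m + r) / 2 < r" "m < (m + r) / 2"
    by auto
  moreover from this(3) have "y \<in> cube x ((m + r) / 2)"
    using m by (fastforce simp: cube_def)
  ultimately show ?thesis
    using that by blast
qed

lemma expands_derivative_bound:
  fixes f :: "'e::euclidean_space \<Rightarrow> 'f::euclidean_space"
  assumes f: "expands_on_cube f x r \<alpha> c" and \<rho>: "0 < \<rho>" "\<rho> < r"
  obtains K where "summable K"
    "\<And>b i y. b \<in> Basis \<Longrightarrow> y \<in> cube x \<rho> \<Longrightarrow>
       norm (monomial ((\<alpha> i)(b := \<alpha> i b - 1)) (y - x) *\<^sub>R real (\<alpha> i b) *\<^sub>R c i) \<le> K i"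
proof
  define \<delta> where "\<delta> = (r - \<rho>) / 2"
  have \<delta>: "\<delta> > 0" "\<rho> + \<delta> < r"
    using \<rho> by (auto simp: \<delta>_def field_simps)
  define K where "K i = norm (monomial (\<alpha> i) ((\<rho> + \<delta>) *\<^sub>R One) *\<^sub>R c i) / \<delta>" for i
  have "x + (\<rho> + \<delta>) *\<^sub>R One \<in> cube x r"
    using \<rho> \<delta> by (simp add: cube_def)
  with f have "((\<lambda>i. monomial (\<alpha> i) ((\<rho> + \<delta>) *\<^sub>R One) *\<^sub>R c i) has_sum f (x + (\<rho> + \<delta>) *\<^sub>R One)) UNIV"
    by (force simp: expands_on_cube_def)
  from has_sum_imp_summable_norm[OF this] show "summable K"
    unfolding K_def by (rule summable_divide)
  fix b y :: 'e and i
  assume b: "b \<in> Basis" and "y \<in> cube x \<rho>"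
  then have "y - x \<in> cube 0 \<rho>"
    by (simp add: cube_def)
  have "monomial (\<alpha> i) ((\<rho> + \<delta>) *\<^sub>R One) \<ge> 0"
    unfolding monomial_scaled_One using \<rho> \<delta> by (intro prod_nonneg) auto
  have "norm (monomial ((\<alpha> i)(b := \<alpha> i b - 1)) (y - x) *\<^sub>R real (\<alpha> i b) *\<^sub>R c i) =
      \<bar>real (\<alpha> i b) * monomial ((\<alpha> i)(b := \<alpha> i b - 1)) (y - x)\<bar> * norm (c i)"
    by (simp add: abs_mult)
  also have "\<dots> \<le> monomial (\<alpha> i) ((\<rho> + \<delta>) *\<^sub>R One) / \<delta> * norm (c i)"
    using \<rho> \<delta> b \<open>y - x \<in> cube 0 \<rho>\<close> by (intro mult_right_mono monomial_derivative_bound) auto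
  also have "\<dots> = K i"
    using \<open>monomial (\<alpha> i) ((\<rho> + \<delta>) *\<^sub>R One) \<ge> 0\<close> by (simp add: K_def)
  finally show "norm (monomial ((\<alpha> i)(b := \<alpha> i b - 1)) (y - x) *\<^sub>R real (\<alpha> i b) *\<^sub>R c i) \<le> K i" .
qed

text \<open>Term by term differentiation. By \<open>expands_derivative_bound\<close> and the Weierstrass test the partial
  derivatives of the partial sums converge uniformly on every smaller cube; hence the total
  derivatives converge uniformly on unit vectors, which is what the theorem on derivatives of series
  asks for.\<close>
lemma expands_has_derivative:
  fixes f :: "'e::euclidean_space \<Rightarrow> 'f::euclidean_space"
  assumes f: "expands_on_cube f x r \<alpha> c"
  obtains D where
    "\<And>y. y \<in> cube x r \<Longrightarrow> (f has_derivative (\<lambda>k. \<Sum>b\<in>Basis. (k \<bullet> b) *\<^sub>R D b y)) (at y)"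
    "\<And>b. b \<in> Basis \<Longrightarrow>
       expands_on_cube (D b) x r (\<lambda>i. (\<alpha> i)(b := \<alpha> i b - 1)) (\<lambda>i. real (\<alpha> i b) *\<^sub>R c i)"
proof
  define u where "u b i y = monomial ((\<alpha> i)(b := \<alpha> i b - 1)) (y - x) *\<^sub>R real (\<alpha> i b) *\<^sub>R c i"
    for b i y
  define D where "D b y = (\<Sum>i. u b i y)" for b y
  show "expands_on_cube (D b) x r (\<lambda>i. (\<alpha> i)(b := \<alpha> i b - 1)) (\<lambda>i. real (\<alpha> i b) *\<^sub>R c i)"
    if "b \<in> Basis" for b
    unfolding expands_on_cube_def u_def[symmetric]
  proof
    fix y assume "y \<in> cube x r"
    then obtain \<rho> where \<rho>: "0 < \<rho>" "\<rho> < r" "y \<in> cube x \<rho>"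
      by (rule cube_shrink)
    obtain K where K: "summable K"
      "\<And>b i y. b \<in> Basis \<Longrightarrow> y \<in> cube x \<rho> \<Longrightarrow> norm (u b i y) \<le> K i"
      using expands_derivative_bound[OF f \<rho>(1,2)] unfolding u_def by blast
    have "summable (\<lambda>i. norm (u b i y))"
      by (rule summable_comparison_test'[OF K(1), of 0]) (use K(2) that \<rho> in auto)
    then show "((\<lambda>i. u b i y) has_sum D b y) UNIV"
      unfolding D_def
      by (intro norm_summable_imp_has_sum) (simp_all add: summable_sums summable_norm_cancel)
  qed
  fix y assume "y \<in> cube x r"
  then obtain \<rho> where \<rho>: "0 < \<rho>" "\<rho> < r" "y \<in> cube x \<rho>"
    by (rule cube_shrink)
  obtain K where K: "summable K"
    "\<And>b i y. b \<in> Basis \<Longrightarrow> y \<in> cube x \<rho> \<Longrightarrow> norm (u b i y) \<le> K i"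
    using expands_derivative_bound[OF f \<rho>(1,2)] unfolding u_def by blast
  have unif: "uniform_limit (cube x \<rho>) (\<lambda>n y. \<Sum>i<n. u b i y) (D b) sequentially"
    if "b \<in> Basis" for b
    unfolding D_def[abs_def] by (rule Weierstrass_m_test[OF _ K(1)]) (use K(2) that in auto)
  have sums: "(\<lambda>i. monomial (\<alpha> i) (z - x) *\<^sub>R c i) sums f z" if "z \<in> cube x \<rho>" for z
  proof -
    have "z \<in> cube x r"
      using that \<rho> cube_mono[of \<rho> r x] by auto
    then show ?thesis
      using f has_sum_imp_sums by (auto simp: expands_on_cube_def)
  qed
  have "\<exists>g. \<forall>z\<in>cube x \<rho>. (\<lambda>i. monomial (\<alpha> i) (z - x) *\<^sub>R c i) sums g z \<and>
      (g has_derivative (\<lambda>k. \<Sum>b\<in>Basis. (k \<bullet> b) *\<^sub>R D b z)) (at z within cube x \<rho>)"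
  proof (rule has_derivative_series)
    show "convex (cube x \<rho>)" "y \<in> cube x \<rho>"
      "(\<lambda>i. monomial (\<alpha> i) (y - x) *\<^sub>R c i) sums f y"
      using convex_cube sums \<rho>(3) by auto
  next
    fix i z assume "z \<in> cube x \<rho>"
    have "((\<lambda>z. monomial (\<alpha> i) (z - x)) has_derivative
        (\<lambda>k. \<Sum>b\<in>Basis. (k \<bullet> b) * (real (\<alpha> i b) * monomial ((\<alpha> i)(b := \<alpha> i b - 1)) (z - x))))
        (at z within cube x \<rho>)"
      by (rule has_derivative_compose[where f = "\<lambda>z. z - x", OF _ has_derivative_monomial])
         (auto intro!: derivative_eq_intros)
    from has_derivative_scaleR_left[OF this, of "c i"]
    show "((\<lambda>z. monomial (\<alpha> i) (z - x) *\<^sub>R c i) has_derivative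
        (\<lambda>k. \<Sum>b\<in>Basis. (k \<bullet> b) *\<^sub>R u b i z)) (at z within cube x \<rho>)"
      by (simp add: u_def scaleR_sum_left mult_ac)
  next
    fix e :: real assume "e > 0"
    define e' where "e' = e / DIM('e)"
    have "e' > 0"
      using \<open>e > 0\<close> by (simp add: e'_def)
    have "\<forall>\<^sub>F n in sequentially. \<forall>b\<in>Basis. \<forall>z\<in>cube x \<rho>. norm ((\<Sum>i<n. u b i z) - D b z) < e'"
      using unif \<open>e' > 0\<close> by (auto simp: eventually_ball_finite_distrib uniform_limit_iff dist_norm)
    then show "\<forall>\<^sub>F n in sequentially. \<forall>z\<in>cube x \<rho>. \<forall>k.
        norm ((\<Sum>i<n. \<Sum>b\<in>Basis. (k \<bullet> b) *\<^sub>R u b i z) - (\<Sum>b\<in>Basis. (k \<bullet> b) *\<^sub>R D b z)) \<le> e * norm k"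
    proof (eventually_elim, intro ballI allI)
      fix n z k assume *: "\<forall>b\<in>Basis. \<forall>z\<in>cube x \<rho>. norm ((\<Sum>i<n. u b i z) - D b z) < e'"
        and z: "z \<in> cube x \<rho>"
      have "(\<Sum>i<n. \<Sum>b\<in>Basis. (k \<bullet> b) *\<^sub>R u b i z) - (\<Sum>b\<in>Basis. (k \<bullet> b) *\<^sub>R D b z) =
          (\<Sum>b\<in>Basis. (k \<bullet> b) *\<^sub>R ((\<Sum>i<n. u b i z) - D b z))"
        by (subst sum.swap) (simp add: scaleR_diff_right sum_subtractf scaleR_sum_right)
      also have "norm \<dots> \<le> (\<Sum>b\<in>(Basis::'e set). norm k * e')"
      proof (rule sum_norm_le)
        fix b :: 'e assume "b \<in> Basis"
        then show "norm ((k \<bullet> b) *\<^sub>R ((\<Sum>i<n. u b i z) - D b z)) \<le> norm k * e'"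
          unfolding norm_scaleR using * z
          by (intro mult_mono Basis_le_norm) (auto intro: less_imp_le)
      qed
      also have "\<dots> = e * norm k"
        by (simp add: e'_def)
      finally show "norm ((\<Sum>i<n. \<Sum>b\<in>Basis. (k \<bullet> b) *\<^sub>R u b i z) - (\<Sum>b\<in>Basis. (k \<bullet> b) *\<^sub>R D b z))
          \<le> e * norm k" .
    qed
  qed
  then obtain g where g: "\<And>z. z \<in> cube x \<rho> \<Longrightarrow> (\<lambda>i. monomial (\<alpha> i) (z - x) *\<^sub>R c i) sums g z"
    "\<And>z. z \<in> cube x \<rho> \<Longrightarrow>
      (g has_derivative (\<lambda>k. \<Sum>b\<in>Basis. (k \<bullet> b) *\<^sub>R D b z)) (at z within cube x \<rho>)"
    by blast
  have "g z = f z" if "z \<in> cube x \<rho>" for z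
    using sums_unique2[OF g(1) sums] that by blast
  with g(2)[OF \<rho>(3)] \<rho>(3)
  have "(f has_derivative (\<lambda>k. \<Sum>b\<in>Basis. (k \<bullet> b) *\<^sub>R D b y)) (at y within cube x \<rho>)"
    by (metis (no_types, lifting) has_derivative_transform)
  then show "(f has_derivative (\<lambda>k. \<Sum>b\<in>Basis. (k \<bullet> b) *\<^sub>R D b y)) (at y)"
    using at_within_open[OF \<rho>(3) open_cube] by simp
qed

section \<open>Calculus of real-analytic functions\<close>

lemma expands_cong:
  "(\<And>y. y \<in> cube x r \<Longrightarrow> f y = g y) \<Longrightarrow> expands_on_cube f x r \<alpha> c = expands_on_cube g x r \<alpha> c"
  by (simp add: expands_on_cube_def)

lemma real_analytic_cong:
  fixes f g :: "'e::euclidean_space \<Rightarrow> 'f::euclidean_space"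
  assumes "real_analytic_on f S" "open S" "\<And>x. x \<in> S \<Longrightarrow> f x = g x"
  shows "real_analytic_on g S"
  unfolding real_analytic_on_iff_expands
proof
  fix x assume "x \<in> S"
  then obtain r \<alpha> c s where "r > 0" "expands_on_cube f x r \<alpha> c" "s > 0" "cube x s \<subseteq> S"
    using assms(1) cube_within_open[OF assms(2)] real_analytic_on_iff_expands by metis
  then have "expands_on_cube f x (min r s) \<alpha> c" "cube x (min r s) \<subseteq> S"
    using expands_mono[of f x r \<alpha> c "min r s"] cube_mono[of "min r s" s x] by auto
  then have "expands_on_cube g x (min r s) \<alpha> c"
    using assms(3) expands_cong[of x "min r s" f g] by blast
  with \<open>r > 0\<close> \<open>s > 0\<close> show "\<exists>r \<alpha> c. r > 0 \<and> expands_on_cube g x r \<alpha> c"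
    by (intro exI[of _ "min r s"]) auto
qed

lemma real_analytic_subset: "real_analytic_on f S \<Longrightarrow> T \<subseteq> S \<Longrightarrow> real_analytic_on f T"
  unfolding real_analytic_on_def by blast

lemma real_analytic_has_derivative:
  assumes "real_analytic_on f S" "x \<in> S"
  shows "(f has_derivative frechet_derivative f (at x)) (at x)"
proof -
  obtain r \<alpha> c where r: "r > 0" and f: "expands_on_cube f x r \<alpha> c"
    using assms real_analytic_on_iff_expands by blast
  obtain D where "(f has_derivative (\<lambda>k. \<Sum>b\<in>Basis. (k \<bullet> b) *\<^sub>R D b x)) (at x)"
    by (rule expands_has_derivative[OF f]) (use centre_in_cube[OF r] in blast)
  then show ?thesis
    unfolding frechet_derivative_works[symmetric] by (rule differentiableI)
qed

lemma expands_partial_derivative: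
  fixes f :: "'e::euclidean_space \<Rightarrow> 'f::euclidean_space"
  assumes f: "expands_on_cube f x r \<alpha> c" and b: "b \<in> Basis"
  shows "expands_on_cube (\<lambda>y. frechet_derivative f (at y) b) x r
    (\<lambda>i. (\<alpha> i)(b := \<alpha> i b - 1)) (\<lambda>i. real (\<alpha> i b) *\<^sub>R c i)"
proof -
  obtain D where D:
    "\<And>y. y \<in> cube x r \<Longrightarrow> (f has_derivative (\<lambda>k. \<Sum>b\<in>Basis. (k \<bullet> b) *\<^sub>R D b y)) (at y)"
    "\<And>b. b \<in> Basis \<Longrightarrow>
       expands_on_cube (D b) x r (\<lambda>i. (\<alpha> i)(b := \<alpha> i b - 1)) (\<lambda>i. real (\<alpha> i b) *\<^sub>R c i)"
    using expands_has_derivative[OF f] by blast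
  have "D b y = frechet_derivative f (at y) b" if "y \<in> cube x r" for y
  proof -
    have "(\<Sum>d\<in>Basis. (b \<bullet> d) *\<^sub>R D d y) = (\<Sum>d\<in>Basis. if d = b then D d y else 0)"
      by (rule sum.cong) (auto simp: inner_Basis b)
    also have "\<dots> = D b y"
      using b by (simp add: sum.delta)
    finally show ?thesis
      using fun_cong[OF frechet_derivative_at[OF D(1)[OF that]], of b] by simp
  qed
  then show ?thesis
    using D(2)[OF b] by (simp add: expands_on_cube_def)
qed

lemma real_analytic_partial_derivative:
  assumes "real_analytic_on f S" "b \<in> Basis"
  shows "real_analytic_on (\<lambda>y. frechet_derivative f (at y) b) S"
  using assms expands_partial_derivative unfolding real_analytic_on_iff_expands by blast

text \<open>Both second derivatives are given by the same series, term by term.\<close>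
lemma real_analytic_mixed_partials:
  fixes f :: "'e::euclidean_space \<Rightarrow> 'f::euclidean_space"
  assumes "real_analytic_on f S" "x \<in> S" "b \<in> Basis" "d \<in> Basis"
  shows "frechet_derivative (\<lambda>y. frechet_derivative f (at y) b) (at x) d =
         frechet_derivative (\<lambda>y. frechet_derivative f (at y) d) (at x) b"
proof (cases "b = d")
  case False
  obtain r \<alpha> c where r: "r > 0" "expands_on_cube f x r \<alpha> c"
    using assms real_analytic_on_iff_expands by blast
  note bd = expands_partial_derivative[OF expands_partial_derivative[OF r(2) assms(3)] assms(4)]
  note db = expands_partial_derivative[OF expands_partial_derivative[OF r(2) assms(4)] assms(3)]
  from bd[unfolded expands_on_cube_def, rule_format, OF centre_in_cube[OF r(1)]]
    db[unfolded expands_on_cube_def, rule_format, OF centre_in_cube[OF r(1)]]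
  show ?thesis
    using False by (simp add: fun_upd_twist mult.commute has_sum_unique)
qed simp

lemma real_analytic_const: "real_analytic_on (\<lambda>_. c) S"
proof -
  have "expands_on_cube (\<lambda>_. c) x 1 (\<lambda>_ _. 0) (\<lambda>i. if i = 0 then c else 0)" for x :: 'a
  proof -
    have "((\<lambda>i. if i = 0 then c else 0) has_sum c) (UNIV :: nat set)"
      by (rule has_sum_finite_neutralI[of "{0}"]) auto
    then show ?thesis
      by (simp add: expands_on_cube_def monomial_def)
  qed
  then show ?thesis
    unfolding real_analytic_on_iff_expands by (metis zero_less_one)
qed

lemma real_analytic_add:
  fixes f g :: "'e::euclidean_space \<Rightarrow> 'f::euclidean_space"
  assumes "real_analytic_on f S" "real_analytic_on g S"
  shows "real_analytic_on (\<lambda>x. f x + g x) S"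
  unfolding real_analytic_on_def
proof
  fix x assume x: "x \<in> S"
  obtain a r where a: "r > 0" "\<And>y. (\<forall>b\<in>Basis. \<bar>(y - x) \<bullet> b\<bar> < r) \<Longrightarrow>
      ((\<lambda>\<alpha>. (\<Prod>b\<in>Basis. ((y - x) \<bullet> b) ^ \<alpha> b) *\<^sub>R a \<alpha>) has_sum f y) (Basis \<rightarrow>\<^sub>E UNIV)"
    using assms(1) x unfolding real_analytic_on_def by meson
  obtain c s where c: "s > 0" "\<And>y. (\<forall>b\<in>Basis. \<bar>(y - x) \<bullet> b\<bar> < s) \<Longrightarrow>
      ((\<lambda>\<alpha>. (\<Prod>b\<in>Basis. ((y - x) \<bullet> b) ^ \<alpha> b) *\<^sub>R c \<alpha>) has_sum g y) (Basis \<rightarrow>\<^sub>E UNIV)"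
    using assms(2) x unfolding real_analytic_on_def by meson
  show "\<exists>a r. r > 0 \<and> (\<forall>y. (\<forall>b\<in>Basis. \<bar>(y - x) \<bullet> b\<bar> < r) \<longrightarrow>
      ((\<lambda>\<alpha>. (\<Prod>b\<in>Basis. ((y - x) \<bullet> b) ^ \<alpha> b) *\<^sub>R a \<alpha>) has_sum f y + g y) (Basis \<rightarrow>\<^sub>E UNIV))"
  proof (intro exI[of _ "\<lambda>\<alpha>. a \<alpha> + c \<alpha>"] exI[of _ "min r s"] conjI allI impI)
    fix y assume "\<forall>b\<in>Basis. \<bar>(y - x) \<bullet> b\<bar> < min r s"
    then show "((\<lambda>\<alpha>. (\<Prod>b\<in>Basis. ((y - x) \<bullet> b) ^ \<alpha> b) *\<^sub>R (a \<alpha> + c \<alpha>)) has_sum f y + g y)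
        (Basis \<rightarrow>\<^sub>E UNIV)"
      unfolding scaleR_add_right by (intro has_sum_add a(2) c(2)) auto
  qed (use a(1) c(1) in auto)
qed

lemma real_analytic_bounded_linear:
  fixes f :: "'e::euclidean_space \<Rightarrow> 'f::euclidean_space" and L :: "'f \<Rightarrow> 'g::euclidean_space"
  assumes "bounded_linear L" "real_analytic_on f S"
  shows "real_analytic_on (\<lambda>x. L (f x)) S"
proof -
  interpret bounded_linear L by fact
  have "expands_on_cube (\<lambda>x. L (f x)) x r \<alpha> (\<lambda>i. L (c i))" if "expands_on_cube f x r \<alpha> c" for x r \<alpha> c
    using that has_sum_bounded_linear[OF assms(1)] by (fastforce simp: expands_on_cube_def scaleR)
  then show ?thesis
    using assms(2) unfolding real_analytic_on_iff_expands by blast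
qed

lemma real_analytic_sum:
  fixes f :: "'i \<Rightarrow> 'e::euclidean_space \<Rightarrow> 'f::euclidean_space"
  assumes "\<And>i. i \<in> I \<Longrightarrow> real_analytic_on (f i) S"
  shows "real_analytic_on (\<lambda>x. \<Sum>i\<in>I. f i x) S"
  using assms
  by (induction I rule: infinite_finite_induct) (auto intro: real_analytic_const real_analytic_add)

lemma real_analytic_diff:
  assumes "real_analytic_on f S" "real_analytic_on g S"
  shows "real_analytic_on (\<lambda>x. f x - g x) S"
  using real_analytic_add[OF assms(1) real_analytic_bounded_linear[OF bounded_linear_minus[OF bounded_linear_ident] assms(2)]]
  by simp

text \<open>Both series converge absolutely, so their product may be summed over pairs of indices.\<close>
lemma has_sum_scaleR_product:
  fixes u :: "nat \<Rightarrow> real" and v :: "nat \<Rightarrow> 'f::euclidean_space"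
  assumes u: "(u has_sum s) UNIV" and v: "(v has_sum t) UNIV"
  shows "((\<lambda>(i, j). u i *\<^sub>R v j) has_sum s *\<^sub>R t) UNIV"
proof -
  have inner: "((\<lambda>j. u i *\<^sub>R v j) has_sum u i *\<^sub>R t) UNIV" for i
    by (rule has_sum_bounded_linear[OF bounded_linear_scaleR_right v])
  have outer: "((\<lambda>i. u i *\<^sub>R t) has_sum s *\<^sub>R t) UNIV"
    by (rule has_sum_bounded_linear[OF bounded_linear_scaleR_left u])
  have nu: "(\<lambda>i. norm (u i)) summable_on UNIV" and nv: "(\<lambda>j. norm (v j)) summable_on UNIV"
    using has_sum_imp_summable_norm[OF u] has_sum_imp_summable_norm[OF v]
    by (simp_all add: summable_on_UNIV_nonneg_real_iff)
  have "(\<lambda>p. norm (case p of (i, j) \<Rightarrow> u i *\<^sub>R v j)) summable_on (SIGMA i:UNIV. UNIV)"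
    unfolding Infinite_Sum.abs_summable_on_Sigma_iff
  proof (intro conjI ballI)
    show "(\<lambda>j. norm (case (i, j) of (i, j) \<Rightarrow> u i *\<^sub>R v j)) summable_on UNIV" for i
      using summable_on_cmult_right[OF nv, of "\<bar>u i\<bar>"] by simp
    have "(\<Sum>\<^sub>\<infinity>j. norm (u i *\<^sub>R v j)) = norm (u i) * (\<Sum>\<^sub>\<infinity>j. norm (v j))" for i
      by (simp add: infsum_cmult_right[OF nv])
    then show "(\<lambda>i. norm (\<Sum>\<^sub>\<infinity>j. norm (case (i, j) of (i, j) \<Rightarrow> u i *\<^sub>R v j))) summable_on UNIV"
      using summable_on_cmult_left[OF nu, of "\<Sum>\<^sub>\<infinity>j. norm (v j)"]
      by (simp add: abs_mult infsum_nonneg)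
  qed
  then have "(\<lambda>(i, j). u i *\<^sub>R v j) summable_on (SIGMA i:UNIV. UNIV)"
    by (rule abs_summable_summable)
  from has_sum_SigmaI[OF _ outer this] inner show ?thesis
    by simp
qed

text \<open>Pairs of terms multiply to terms whose exponents add; the pairs are enumerated by the naturals.\<close>
lemma real_analytic_scaleR:
  fixes f :: "'e::euclidean_space \<Rightarrow> real" and g :: "'e \<Rightarrow> 'f::euclidean_space"
  assumes "real_analytic_on f S" "real_analytic_on g S"
  shows "real_analytic_on (\<lambda>x. f x *\<^sub>R g x) S"
  unfolding real_analytic_on_iff_expands
proof
  fix x assume x: "x \<in> S"
  obtain r \<alpha> c where r: "r > 0" "expands_on_cube f x r \<alpha> c"
    using assms(1) x real_analytic_on_iff_expands by blast
  obtain s \<beta> d where s: "s > 0" "expands_on_cube g x s \<beta> d"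
    using assms(2) x real_analytic_on_iff_expands by blast
  define t where "t = min r s"
  have t: "t > 0" "expands_on_cube f x t \<alpha> c" "expands_on_cube g x t \<beta> d"
    using r s expands_mono[OF r(2), of t] expands_mono[OF s(2), of t] by (auto simp: t_def)
  define \<gamma> where "\<gamma> = (\<lambda>(i, j) b. \<alpha> i b + \<beta> j b)"
  have "expands_on_cube (\<lambda>x. f x *\<^sub>R g x) x t (\<lambda>n. \<gamma> (prod_decode n)) (\<lambda>n. case prod_decode n of (i, j) \<Rightarrow> c i *\<^sub>R d j)"
    unfolding expands_on_cube_def
  proof
    fix y assume y: "y \<in> cube x t"
    define F where "F = (\<lambda>(i, j). (monomial (\<alpha> i) (y - x) *\<^sub>R c i) *\<^sub>R (monomial (\<beta> j) (y - x) *\<^sub>R d j))"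
    have "(F has_sum f y *\<^sub>R g y) UNIV"
      unfolding F_def
      by (rule has_sum_scaleR_product) (use t(2,3) y in \<open>auto simp: expands_on_cube_def\<close>)
    then have "((\<lambda>n. F (prod_decode n)) has_sum f y *\<^sub>R g y) UNIV"
      using has_sum_reindex_bij_betw[OF bij_prod_decode] by blast
    moreover have "F (i, j) = monomial (\<gamma> (i, j)) (y - x) *\<^sub>R (c i *\<^sub>R d j)" for i j
      by (simp add: F_def \<gamma>_def monomial_add)
    then have "F p = monomial (\<gamma> p) (y - x) *\<^sub>R (case p of (i, j) \<Rightarrow> c i *\<^sub>R d j)" for p
      by (cases p) simp
    ultimately show "((\<lambda>n. monomial (\<gamma> (prod_decode n)) (y - x) *\<^sub>R
        (case prod_decode n of (i, j) \<Rightarrow> c i *\<^sub>R d j)) has_sum f y *\<^sub>R g y) UNIV"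
      by simp
  qed
  with t(1) show "\<exists>r \<alpha> c. r > 0 \<and> expands_on_cube (\<lambda>x. f x *\<^sub>R g x) x r \<alpha> c"
    by blast
qed

section \<open>Brackets and exterior derivatives in coordinates\<close>

lemma linear_eq_sum_Basis:
  fixes L :: "'e::euclidean_space \<Rightarrow> 'f::real_vector"
  assumes "linear L"
  shows "L u = (\<Sum>b\<in>Basis. (u \<bullet> b) *\<^sub>R L b)"
proof -
  interpret linear L by fact
  have "L u = L (\<Sum>b\<in>Basis. (u \<bullet> b) *\<^sub>R b)"
    by (simp add: euclidean_representation)
  then show ?thesis
    by (simp add: sum scaleR)
qed

text \<open>\<open>hessian f x v u\<close> is the second derivative of \<open>f\<close> at \<open>x\<close>, where \<open>v\<close> is the direction of the
  second differentiation.\<close>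
definition hessian :: "('e::euclidean_space \<Rightarrow> 'f::euclidean_space) \<Rightarrow> 'e \<Rightarrow> 'e \<Rightarrow> 'e \<Rightarrow> 'f" where
  "hessian f x v u = (\<Sum>b\<in>Basis. (u \<bullet> b) *\<^sub>R frechet_derivative (\<lambda>y. frechet_derivative f (at y) b) (at x) v)"

lemma hessian_symmetric:
  assumes "real_analytic_on f S" "x \<in> S"
  shows "hessian f x v u = hessian f x u v"
proof -
  have lin: "linear (frechet_derivative (\<lambda>y. frechet_derivative f (at y) b) (at x))" if "b \<in> Basis" for b
    using real_analytic_has_derivative[OF real_analytic_partial_derivative[OF assms(1) that] assms(2)]
    by (rule has_derivative_linear)
  have *: "hessian f x v u = (\<Sum>b\<in>Basis. \<Sum>d\<in>Basis. (u \<bullet> b) *\<^sub>R (v \<bullet> d) *\<^sub>R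
      frechet_derivative (\<lambda>y. frechet_derivative f (at y) b) (at x) d)" for u v
    unfolding hessian_def scaleR_sum_right[symmetric]
    by (intro sum.cong refl) (subst linear_eq_sum_Basis[OF lin], simp_all)
  show ?thesis
    unfolding * by (subst sum.swap)
      (intro sum.cong refl, simp add: mult.commute real_analytic_mixed_partials[OF assms])
qed

lemma has_derivative_derivative_along:
  fixes f :: "'e::euclidean_space \<Rightarrow> 'f::euclidean_space"
  assumes f: "real_analytic_on f S" and S: "open S" "x \<in> S" and y: "(y has_derivative y') (at x)"
  shows "((\<lambda>z. frechet_derivative f (at z) (y z)) has_derivative
    (\<lambda>v. frechet_derivative f (at x) (y' v) + hessian f x v (y x))) (at x)"
proof -
  have lin: "linear (frechet_derivative f (at z))" if "z \<in> S" for z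
    using real_analytic_has_derivative[OF f that] by (rule has_derivative_linear)
  have D: "((\<lambda>z. frechet_derivative f (at z) b) has_derivative
      frechet_derivative (\<lambda>z. frechet_derivative f (at z) b) (at x)) (at x)" if "b \<in> Basis" for b
    by (rule real_analytic_has_derivative[OF real_analytic_partial_derivative[OF f that] S(2)])
  have "((\<lambda>z. \<Sum>b\<in>Basis. (y z \<bullet> b) *\<^sub>R frechet_derivative f (at z) b) has_derivative
      (\<lambda>v. \<Sum>b\<in>Basis. (y x \<bullet> b) *\<^sub>R frechet_derivative (\<lambda>z. frechet_derivative f (at z) b) (at x) v +
        (y' v \<bullet> b) *\<^sub>R frechet_derivative f (at x) b)) (at x)"
    by (intro has_derivative_sum has_derivative_scaleR has_derivative_inner_left y D)
  also have "(\<lambda>v. \<Sum>b\<in>Basis. (y x \<bullet> b) *\<^sub>R frechet_derivative (\<lambda>z. frechet_derivative f (at z) b) (at x) v +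
        (y' v \<bullet> b) *\<^sub>R frechet_derivative f (at x) b) =
      (\<lambda>v. frechet_derivative f (at x) (y' v) + hessian f x v (y x))"
    unfolding hessian_def sum.distrib linear_eq_sum_Basis[OF lin[OF S(2)], symmetric] by (simp add: add.commute)
  finally show ?thesis
    by (rule has_derivative_transform_within_open[OF _ S])
       (simp add: linear_eq_sum_Basis[OF lin, symmetric])
qed

definition bracket_in_coords :: "('e::euclidean_space \<Rightarrow> 'e) \<Rightarrow> ('e \<Rightarrow> 'e) \<Rightarrow> 'e \<Rightarrow> 'e" where
  "bracket_in_coords y z x = frechet_derivative z (at x) (y x) - frechet_derivative y (at x) (z x)"

text \<open>The fields on the two sides are related by the derivative of \<open>f\<close>. Differentiating these
  relations produces, besides the transformed derivatives, a second derivative of \<open>f\<close>; by symmetry it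
  cancels in the bracket. Hence brackets of vector fields are again vector fields.\<close>
lemma bracket_in_coords_change:
  assumes f: "real_analytic_on f S" and S: "open S" "x \<in> S"
    and y: "y differentiable at x" and z: "z differentiable at x"
    and y': "y' differentiable at (f x)" and z': "z' differentiable at (f x)"
    and yy': "\<And>u. u \<in> S \<Longrightarrow> y' (f u) = frechet_derivative f (at u) (y u)"
    and zz': "\<And>u. u \<in> S \<Longrightarrow> z' (f u) = frechet_derivative f (at u) (z u)"
  shows "bracket_in_coords y' z' (f x) = frechet_derivative f (at x) (bracket_in_coords y z x)"
proof -
  have f': "(f has_derivative frechet_derivative f (at x)) (at x)"
    by (rule real_analytic_has_derivative[OF f S(2)])
  interpret F: linear "frechet_derivative f (at x)"
    using f' by (rule has_derivative_linear)
  have *: "frechet_derivative w' (at (f x)) (frechet_derivative f (at x) v) =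
      frechet_derivative f (at x) (frechet_derivative w (at x) v) + hessian f x v (w x)"
    if "w differentiable at x" "w' differentiable at (f x)"
      "\<And>u. u \<in> S \<Longrightarrow> w' (f u) = frechet_derivative f (at u) (w u)" for w w' v
  proof -
    have "((\<lambda>u. w' (f u)) has_derivative
        (\<lambda>v. frechet_derivative w' (at (f x)) (frechet_derivative f (at x) v))) (at x)"
      using has_derivative_compose[OF f', of w'] that(2)[unfolded frechet_derivative_works] by blast
    moreover have "((\<lambda>u. w' (f u)) has_derivative
        (\<lambda>v. frechet_derivative f (at x) (frechet_derivative w (at x) v) + hessian f x v (w x))) (at x)"
      by (rule has_derivative_transform_within_open[OF has_derivative_derivative_along[OF f S] S])
         (use that in \<open>simp_all add: frechet_derivative_works\<close>)
    ultimately show ?thesis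
      using fun_cong[OF has_derivative_unique, of _ _ _ _ v] by blast
  qed
  have "frechet_derivative z' (at (f x)) (y' (f x)) =
      frechet_derivative f (at x) (frechet_derivative z (at x) (y x)) + hessian f x (y x) (z x)"
    unfolding yy'[OF S(2)] by (rule *[OF z z']) (rule zz')
  moreover have "frechet_derivative y' (at (f x)) (z' (f x)) =
      frechet_derivative f (at x) (frechet_derivative y (at x) (z x)) + hessian f x (z x) (y x)"
    unfolding zz'[OF S(2)] by (rule *[OF y y']) (rule yy')
  ultimately show ?thesis
    by (simp add: bracket_in_coords_def F.diff hessian_symmetric[OF f S(2), of "z x" "y x"])
qed

lemma real_analytic_differentiable: "real_analytic_on f S \<Longrightarrow> x \<in> S \<Longrightarrow> f differentiable at x"
  unfolding frechet_derivative_works by (rule real_analytic_has_derivative)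

lemma real_analytic_derivative_along:
  assumes "real_analytic_on y S" "real_analytic_on f S" "open S"
  shows "real_analytic_on (\<lambda>x. frechet_derivative f (at x) (y x)) S"
proof (rule real_analytic_cong[OF _ assms(3)])
  show "real_analytic_on (\<lambda>x. \<Sum>b\<in>Basis. (y x \<bullet> b) *\<^sub>R frechet_derivative f (at x) b) S"
    by (intro real_analytic_sum real_analytic_scaleR real_analytic_partial_derivative assms
        real_analytic_bounded_linear[OF bounded_linear_inner_left])
  show "(\<Sum>b\<in>Basis. (y x \<bullet> b) *\<^sub>R frechet_derivative f (at x) b) = frechet_derivative f (at x) (y x)"
    if "x \<in> S" for x
    by (rule linear_eq_sum_Basis[OF has_derivative_linear, symmetric])
       (rule real_analytic_has_derivative[OF assms(2) that])
qed

lemma real_analytic_bracket_in_coords: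
  assumes "real_analytic_on y S" "real_analytic_on z S" "open S"
  shows "real_analytic_on (bracket_in_coords y z) S"
  unfolding bracket_in_coords_def
  by (intro real_analytic_diff real_analytic_derivative_along assms)

text \<open>The exterior derivative of the 1-form \<open>\<theta>\<close>, with covectors written as vectors by means of the
  inner product.\<close>
definition ext_deriv :: "('e::euclidean_space \<Rightarrow> 'e) \<Rightarrow> 'e \<Rightarrow> 'e \<Rightarrow> 'e \<Rightarrow> real" where
  "ext_deriv \<theta> x u v = frechet_derivative \<theta> (at x) u \<bullet> v - frechet_derivative \<theta> (at x) v \<bullet> u"

text \<open>Cartan's formula \<open>d\<theta>(Y, Z) = Y \<theta>(Z) - Z \<theta>(Y) - \<theta>([Y, Z])\<close> for fields annihilated by
  \<open>\<theta>\<close>. The left-hand side of the lemma depends on derivatives of the fields, the right-hand side only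
  on their values: this turns integrability into linear algebra at each point.\<close>
lemma inner_bracket_in_coords:
  assumes S: "open S" "x \<in> S"
    and y: "y differentiable at x" and z: "z differentiable at x" and \<theta>: "\<theta> differentiable at x"
    and "\<And>u. u \<in> S \<Longrightarrow> \<theta> u \<bullet> y u = 0" "\<And>u. u \<in> S \<Longrightarrow> \<theta> u \<bullet> z u = 0"
  shows "\<theta> x \<bullet> bracket_in_coords y z x = - ext_deriv \<theta> x (y x) (z x)"
proof -
  have *: "\<theta> x \<bullet> frechet_derivative w (at x) v + frechet_derivative \<theta> (at x) v \<bullet> w x = 0"
    if "w differentiable at x" "\<And>u. u \<in> S \<Longrightarrow> \<theta> u \<bullet> w u = 0" for w :: "'a \<Rightarrow> 'a" and v
  proof -
    have "((\<lambda>u. \<theta> u \<bullet> w u) has_derivative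
        (\<lambda>v. \<theta> x \<bullet> frechet_derivative w (at x) v + frechet_derivative \<theta> (at x) v \<bullet> w x)) (at x)"
      using \<theta> that(1) unfolding frechet_derivative_works by (intro has_derivative_inner)
    moreover have "((\<lambda>u. \<theta> u \<bullet> w u) has_derivative (\<lambda>v. 0)) (at x)"
      by (rule has_derivative_transform_within_open[OF has_derivative_const S]) (simp add: that(2))
    ultimately show ?thesis
      using fun_cong[OF has_derivative_unique, of _ _ _ _ v] by blast
  qed
  show ?thesis
    using *[OF y assms(6), of "z x"] *[OF z assms(7), of "y x"]
    by (simp add: bracket_in_coords_def ext_deriv_def inner_diff_right)
qed

section \<open>Tangent vectors, brackets and 1-forms on a manifold\<close>

lemma is_chart_open_image:
  assumes "is_chart X c" "openin X U"
  shows "open (snd c ` (U \<inter> fst c))"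
proof -
  have "open_map (subtopology X (fst c)) (top_of_set (snd c ` fst c)) (snd c)"
    using assms(1) homeomorphic_imp_open_map unfolding is_chart_def by blast
  moreover have "openin (subtopology X (fst c)) (U \<inter> fst c)"
    using assms(2) by (auto simp: openin_subtopology)
  ultimately have "openin (top_of_set (snd c ` fst c)) (snd c ` (U \<inter> fst c))"
    unfolding open_map_def by blast
  then show ?thesis
    using assms(1) openin_open_trans unfolding is_chart_def by blast
qed

lemma is_chart_inj_on:
  assumes "is_chart X c"
  shows "inj_on (snd c) (fst c)"
proof -
  have "fst c \<subseteq> topspace X"
    using assms openin_subset unfolding is_chart_def by blast
  then have "topspace (subtopology X (fst c)) = fst c"
    by auto
  then show ?thesis
    using assms homeomorphic_imp_injective_map unfolding is_chart_def by metis
qed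

lemma tangent_space_transform:
  "v \<in> tangent_space A p \<Longrightarrow> c \<in> A \<Longrightarrow> d \<in> A \<Longrightarrow> p \<in> fst c \<Longrightarrow> p \<in> fst d \<Longrightarrow>
    v d = frechet_derivative (transition c d) (at (snd c p)) (v c)"
  unfolding tangent_space_def by blast

lemma coord_vector_of_coords:
  assumes "v \<in> tangent_space A p" "c \<in> A" "p \<in> fst c"
  shows "coord_vector A c p (v c) = v"
proof
  fix d
  show "coord_vector A c p (v c) d = v d"
  proof (cases "d \<in> A \<and> p \<in> fst d")
    case True
    then show ?thesis
      unfolding coord_vector_def if_P[OF True]
      by (intro tangent_space_transform[OF assms(1,2) _ assms(3), symmetric]) auto
  next
    case False
    then have "v d = 0"
      using assms(1) unfolding tangent_space_def by blast
    then show ?thesis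
      unfolding coord_vector_def if_not_P[OF False] by (rule sym)
  qed
qed

lemma tangent_vector_eqI:
  assumes "u \<in> tangent_space A p" "v \<in> tangent_space A p" "c \<in> A" "p \<in> fst c" "u c = v c"
  shows "u = v"
proof -
  have "u = coord_vector A c p (u c)"
    by (rule coord_vector_of_coords[OF assms(1,3,4), symmetric])
  also have "\<dots> = v"
    unfolding assms(5) by (rule coord_vector_of_coords[OF assms(2,3,4)])
  finally show ?thesis .
qed

text \<open>The vector of the model space that represents a covector through the inner product and the chart.\<close>
definition covector_coords ::
    "('m, 'e::euclidean_space) chart set \<Rightarrow> ('m, 'e) chart \<Rightarrow> 'm \<Rightarrow> (('m, 'e) tvec \<Rightarrow> real) \<Rightarrow> 'e" where
  "covector_coords A c p \<omega> = (\<Sum>b\<in>Basis. \<omega> (coord_vector A c p b) *\<^sub>R b)"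

lemma linear_covector_coords: "linear (covector_coords A c p)"
proof (rule linearI)
  show "covector_coords A c p (\<omega> + \<eta>) = covector_coords A c p \<omega> + covector_coords A c p \<eta>" for \<omega> \<eta>
    unfolding covector_coords_def sum.distrib[symmetric] plus_fun_def scaleR_add_left ..
  show "covector_coords A c p (r *\<^sub>R \<omega>) = r *\<^sub>R covector_coords A c p \<omega>" for r \<omega>
    unfolding covector_coords_def scaleR_sum_right scaleR_fun_def scaleR_scaleR real_scaleR_def ..
qed

locale atlas =
  fixes X :: "'m topology" and A :: "('m, 'e::euclidean_space) chart set"
  assumes manifold: "analytic_manifold X A"
begin

lemma chart_in_atlas: "c \<in> A \<Longrightarrow> is_chart X c"
  using manifold by (simp add: analytic_manifold_def)

lemma openin_chart_domain: "c \<in> A \<Longrightarrow> openin X (fst c)"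
  using chart_in_atlas by (simp add: is_chart_def)

lemma chart_inv_chart: "c \<in> A \<Longrightarrow> p \<in> fst c \<Longrightarrow> chart_inv c (snd c p) = p"
  unfolding chart_inv_def by (rule inv_into_f_f) (auto intro: is_chart_inj_on chart_in_atlas)

lemma transition_chart: "c \<in> A \<Longrightarrow> p \<in> fst c \<Longrightarrow> transition c d (snd c p) = snd d p"
  by (simp add: transition_def chart_inv_chart)

lemma open_chart_image: "c \<in> A \<Longrightarrow> openin X U \<Longrightarrow> open (snd c ` (U \<inter> fst c))"
  by (rule is_chart_open_image[OF chart_in_atlas])

lemma real_analytic_transition:
  "c \<in> A \<Longrightarrow> d \<in> A \<Longrightarrow> real_analytic_on (transition c d) (snd c ` (fst c \<inter> fst d))"
  using manifold by (simp add: analytic_manifold_def)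

lemma transition_has_derivative:
  assumes "c \<in> A" "d \<in> A" "p \<in> fst c" "p \<in> fst d"
  shows "(transition c d has_derivative frechet_derivative (transition c d) (at (snd c p))) (at (snd c p))"
  by (rule real_analytic_has_derivative[OF real_analytic_transition]) (use assms in auto)

lemma transition_derivative_self:
  assumes "c \<in> A" "p \<in> fst c"
  shows "frechet_derivative (transition c c) (at (snd c p)) e = e"
proof -
  have "open (snd c ` (fst c \<inter> fst c))"
    by (intro open_chart_image openin_chart_domain assms)
  then have "(transition c c has_derivative (\<lambda>v. v)) (at (snd c p))"
    by (rule has_derivative_transform_within_open[OF has_derivative_ident])
       (use assms in \<open>auto simp: transition_chart\<close>)
  from frechet_derivative_at[OF this] show ?thesis
    by metis
qed

lemma transition_derivative_cocycle:
  assumes "c \<in> A" "d \<in> A" "d' \<in> A" "p \<in> fst c" "p \<in> fst d" "p \<in> fst d'"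
  shows "frechet_derivative (transition d d') (at (snd d p))
      (frechet_derivative (transition c d) (at (snd c p)) e) =
    frechet_derivative (transition c d') (at (snd c p)) e"
proof -
  let ?S = "snd c ` ((fst d \<inter> fst d') \<inter> fst c)"
  have S: "open ?S" "snd c p \<in> ?S"
    using assms by (auto intro!: open_chart_image openin_Int openin_chart_domain)
  have "(transition d d' has_derivative frechet_derivative (transition d d') (at (snd d p)))
      (at (transition c d (snd c p)))"
    using transition_has_derivative[of d d' p] assms by (simp add: transition_chart)
  from has_derivative_compose[OF transition_has_derivative[of c d p] this]
  have "((\<lambda>x. transition d d' (transition c d x)) has_derivative
      (\<lambda>e. frechet_derivative (transition d d') (at (snd d p))
        (frechet_derivative (transition c d) (at (snd c p)) e))) (at (snd c p))"
    using assms by simp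
  then have "(transition c d' has_derivative
      (\<lambda>e. frechet_derivative (transition d d') (at (snd d p))
        (frechet_derivative (transition c d) (at (snd c p)) e))) (at (snd c p))"
    by (rule has_derivative_transform_within_open[OF _ S]) (use assms in \<open>auto simp: transition_chart\<close>)
  from fun_cong[OF frechet_derivative_at[OF this], of e] show ?thesis .
qed

lemma coord_vector_in_tangent_space:
  assumes "c \<in> A" "p \<in> fst c"
  shows "coord_vector A c p e \<in> tangent_space A p"
  using assms by (auto simp: tangent_space_def coord_vector_def transition_derivative_cocycle)

lemma coord_vector_own_chart:
  assumes "c \<in> A" "p \<in> fst c"
  shows "coord_vector A c p e c = e"
  using assms by (simp add: coord_vector_def transition_derivative_self)

lemma linear_transition_derivative:
  assumes "c \<in> A" "d \<in> A" "p \<in> fst c" "p \<in> fst d"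
  shows "linear (frechet_derivative (transition c d) (at (snd c p)))"
  using transition_has_derivative[OF assms] by (rule has_derivative_linear)

lemma linear_coord_vector:
  assumes "c \<in> A" "p \<in> fst c"
  shows "linear (coord_vector A c p)"
  using assms
  by (auto intro!: linearI ext simp: coord_vector_def plus_fun_def scaleR_fun_def
      linear_add[OF linear_transition_derivative] linear_scale[OF linear_transition_derivative])

lemma tangent_space_eq_range:
  assumes "c \<in> A" "p \<in> fst c"
  shows "tangent_space A p = range (coord_vector A c p)"
proof (intro equalityI subsetI)
  fix v assume "v \<in> tangent_space A p"
  from coord_vector_of_coords[OF this assms, symmetric] show "v \<in> range (coord_vector A c p)"
    by (rule range_eqI)
qed (auto intro: coord_vector_in_tangent_space[OF assms])

lemma subspace_tangent_space:
  assumes "c \<in> A" "p \<in> fst c"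
  shows "subspace (tangent_space A p)"
  unfolding tangent_space_eq_range[OF assms]
  using linear_subspace_image[OF linear_coord_vector[OF assms] subspace_UNIV] .

lemma covector_apply:
  assumes "c \<in> A" "p \<in> fst c" "\<omega> \<in> cotangent_space A p" "v \<in> tangent_space A p"
  shows "\<omega> v = covector_coords A c p \<omega> \<bullet> v c"
proof -
  note cv = coord_vector_in_tangent_space[OF assms(1,2)]
  have "linear (\<lambda>e. \<omega> (coord_vector A c p e))"
    by (rule linearI)
       (use cv assms(3) linear_coord_vector[OF assms(1,2)] in
         \<open>simp_all add: cotangent_space_def linear_add linear_scale\<close>)
  from linear_eq_sum_Basis[OF this, of "v c"]
  have "\<omega> v = (\<Sum>b\<in>Basis. (v c \<bullet> b) *\<^sub>R \<omega> (coord_vector A c p b))"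
    by (simp add: coord_vector_of_coords assms)
  also have "\<dots> = covector_coords A c p \<omega> \<bullet> v c"
    unfolding covector_coords_def inner_sum_left
    by (rule sum.cong) (simp_all add: inner_commute mult.commute)
  finally show ?thesis .
qed

lemma covector_coords_inj_on:
  assumes "c \<in> A" "p \<in> fst c"
  shows "inj_on (covector_coords A c p) (cotangent_space A p)"
proof (rule inj_onI, rule ext)
  fix \<omega> \<eta> v
  assume *: "\<omega> \<in> cotangent_space A p" "\<eta> \<in> cotangent_space A p"
    "covector_coords A c p \<omega> = covector_coords A c p \<eta>"
  show "\<omega> v = \<eta> v"
  proof (cases "v \<in> tangent_space A p")
    case True
    then show ?thesis
      using covector_apply[OF assms] * by metis
  next
    case False
    with * show ?thesis
      by (simp add: cotangent_space_def)
  qed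
qed

lemma vector_field_transform:
  assumes "analytic_vector_field A U Y" "c \<in> A" "d \<in> A" "p \<in> U" "p \<in> fst c" "p \<in> fst d"
  shows "vector_field_in_chart d Y (transition c d (snd c p)) =
    frechet_derivative (transition c d) (at (snd c p)) (vector_field_in_chart c Y (snd c p))"
  using assms tangent_space_transform[of "Y p" A p c d]
  by (simp add: vector_field_in_chart_def transition_chart chart_inv_chart analytic_vector_field_def)

lemma vector_field_differentiable:
  assumes "analytic_vector_field A U Y" "c \<in> A" "p \<in> U" "p \<in> fst c"
  shows "vector_field_in_chart c Y differentiable at (snd c p)"
  by (rule real_analytic_differentiable[where S = "snd c ` (U \<inter> fst c)"])
     (use assms in \<open>auto simp: analytic_vector_field_def\<close>)

lemma lie_bracket_in_chart:
  assumes "c \<in> A" "p \<in> fst c"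
  shows "lie_bracket A Y Z p c =
    bracket_in_coords (vector_field_in_chart c Y) (vector_field_in_chart c Z) (snd c p)"
  using assms by (simp add: lie_bracket_def bracket_in_coords_def vector_field_in_chart_def chart_inv_chart)

lemma lie_bracket_tangent:
  assumes Y: "analytic_vector_field A U Y" and Z: "analytic_vector_field A U Z"
    and U: "openin X U" "p \<in> U"
  shows "lie_bracket A Y Z p \<in> tangent_space A p"
  unfolding tangent_space_def
proof (intro CollectI conjI ballI impI allI)
  fix c d assume c: "c \<in> A" "p \<in> fst c" and d: "d \<in> A" "p \<in> fst d"
  let ?S = "snd c ` ((U \<inter> fst d) \<inter> fst c)"
  have "bracket_in_coords (vector_field_in_chart d Y) (vector_field_in_chart d Z)
      (transition c d (snd c p)) = frechet_derivative (transition c d) (at (snd c p))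
      (bracket_in_coords (vector_field_in_chart c Y) (vector_field_in_chart c Z) (snd c p))"
  proof (rule bracket_in_coords_change)
    show "real_analytic_on (transition c d) ?S"
      by (rule real_analytic_subset[OF real_analytic_transition[OF c(1) d(1)]]) auto
    show "open ?S"
      using U c d by (intro open_chart_image openin_Int openin_chart_domain)
    show "snd c p \<in> ?S"
      using U c d by auto
    show "vector_field_in_chart c Y differentiable at (snd c p)"
      "vector_field_in_chart c Z differentiable at (snd c p)"
      "vector_field_in_chart d Y differentiable at (transition c d (snd c p))"
      "vector_field_in_chart d Z differentiable at (transition c d (snd c p))"
      using U c d vector_field_differentiable[OF Y] vector_field_differentiable[OF Z]
      by (simp_all add: transition_chart)
    fix x assume "x \<in> ?S"
    then obtain q where q: "x = snd c q" "q \<in> U" "q \<in> fst c" "q \<in> fst d"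
      by blast
    show "vector_field_in_chart d Y (transition c d x) =
        frechet_derivative (transition c d) (at x) (vector_field_in_chart c Y x)"
      "vector_field_in_chart d Z (transition c d x) =
        frechet_derivative (transition c d) (at x) (vector_field_in_chart c Z x)"
      unfolding q(1)
      by (rule vector_field_transform[OF Y c(1) d(1) q(2,3,4)],
          rule vector_field_transform[OF Z c(1) d(1) q(2,3,4)])
  qed
  then show "lie_bracket A Y Z p d =
      frechet_derivative (transition c d) (at (snd c p)) (lie_bracket A Y Z p c)"
    using c d by (simp add: lie_bracket_in_chart transition_chart)
qed (auto simp: lie_bracket_def)

lemma analytic_lie_bracket:
  assumes Y: "analytic_vector_field A U Y" and Z: "analytic_vector_field A U Z" and U: "openin X U"
  shows "analytic_vector_field A U (lie_bracket A Y Z)"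
  unfolding analytic_vector_field_def
proof (intro conjI ballI)
  show "lie_bracket A Y Z p \<in> tangent_space A p" if "p \<in> U" for p
    by (rule lie_bracket_tangent[OF Y Z U that])
  fix c assume c: "c \<in> A"
  let ?S = "snd c ` (U \<inter> fst c)"
  have S: "open ?S"
    by (rule open_chart_image[OF c U])
  have "real_analytic_on (bracket_in_coords (vector_field_in_chart c Y) (vector_field_in_chart c Z)) ?S"
    by (rule real_analytic_bracket_in_coords[OF _ _ S])
       (use Y Z c in \<open>auto simp: analytic_vector_field_def\<close>)
  then show "real_analytic_on (vector_field_in_chart c (lie_bracket A Y Z)) ?S"
    by (rule real_analytic_cong[OF _ S])
       (use c in \<open>auto simp: vector_field_in_chart_def[of c "lie_bracket A Y Z"] chart_inv_chart lie_bracket_in_chart\<close>)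
qed

definition form_in_chart :: "('m, 'e) chart \<Rightarrow> ('m \<Rightarrow> ('m, 'e) tvec \<Rightarrow> real) \<Rightarrow> 'e \<Rightarrow> 'e" where
  "form_in_chart c \<omega> = (\<lambda>x. covector_coords A c (chart_inv c x) (\<omega> (chart_inv c x)))"

lemma real_analytic_form_in_chart:
  assumes "analytic_one_form A U \<omega>" "c \<in> A"
  shows "real_analytic_on (form_in_chart c \<omega>) (snd c ` (U \<inter> fst c))"
  unfolding form_in_chart_def covector_coords_def
  by (intro real_analytic_sum real_analytic_scaleR real_analytic_const)
     (use assms in \<open>auto simp: analytic_one_form_def\<close>)

lemma form_lie_bracket:
  assumes Y: "analytic_vector_field A U Y" and Z: "analytic_vector_field A U Z"
    and \<omega>: "\<And>q. q \<in> U \<Longrightarrow> \<omega> q \<in> cotangent_space A q"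
    and diff: "form_in_chart c \<omega> differentiable at (snd c p)"
    and U: "openin X U" "p \<in> U" and c: "c \<in> A" "p \<in> fst c"
    and 0: "\<And>q. q \<in> U \<Longrightarrow> \<omega> q (Y q) = 0" "\<And>q. q \<in> U \<Longrightarrow> \<omega> q (Z q) = 0"
  shows "\<omega> p (lie_bracket A Y Z p) = - ext_deriv (form_in_chart c \<omega>) (snd c p) (Y p c) (Z p c)"
proof -
  let ?S = "snd c ` (U \<inter> fst c)"
  have *: "form_in_chart c \<omega> (snd c q) \<bullet> vector_field_in_chart c W (snd c q) = \<omega> q (W q)"
    if "q \<in> U" "q \<in> fst c" "analytic_vector_field A U W" for q W
    using that c covector_apply[of c q "\<omega> q" "W q"] \<omega>[of q]
    by (simp add: form_in_chart_def vector_field_in_chart_def chart_inv_chart analytic_vector_field_def)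
  have "form_in_chart c \<omega> (snd c p) \<bullet>
      bracket_in_coords (vector_field_in_chart c Y) (vector_field_in_chart c Z) (snd c p) =
    - ext_deriv (form_in_chart c \<omega>) (snd c p)
      (vector_field_in_chart c Y (snd c p)) (vector_field_in_chart c Z (snd c p))"
    using U c 0 * Y Z
    by (intro inner_bracket_in_coords[of ?S] open_chart_image vector_field_differentiable[OF Y]
        vector_field_differentiable[OF Z] diff) auto
  moreover have "\<omega> p (lie_bracket A Y Z p) = covector_coords A c p (\<omega> p) \<bullet> lie_bracket A Y Z p c"
    by (intro covector_apply c \<omega> lie_bracket_tangent[OF Y Z] U)
  ultimately show ?thesis
    using c by (simp add: form_in_chart_def vector_field_in_chart_def chart_inv_chart lie_bracket_in_chart)
qed

end

section \<open>Polynomial families of bilinear forms\<close>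

lemma linear_veronese_form:
  "linear L \<Longrightarrow> L (veronese_form n g t i) = veronese_form n (\<lambda>i j. L (g i j)) t i"
  by (cases t) (simp_all add: veronese_form_def linear_sum linear_scale)

text \<open>Coordinate functionals of a basis are represented by vectors through the inner product.\<close>
lemma dual_basis:
  fixes g :: "'i \<Rightarrow> 'e::euclidean_space"
  assumes fin: "finite I" and ind: "independent_family I g" and card: "card I = DIM('e)"
  obtains E where
    "\<And>i j. i \<in> I \<Longrightarrow> j \<in> I \<Longrightarrow> g i \<bullet> E j = (if i = j then 1 else 0)"
    "\<And>e. e = (\<Sum>i\<in>I. (g i \<bullet> e) *\<^sub>R E i)"
proof -
  have inj: "inj_on g I" and indep: "independent (g ` I)"
    using ind by (auto simp: independent_family_def)
  have "\<exists>e. \<forall>i\<in>I. g i \<bullet> e = (if i = j then 1 else 0)" for j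
  proof -
    obtain h :: "'e \<Rightarrow> real" where h: "linear h"
      "\<forall>x\<in>g ` I. h x = (if inv_into I g x = j then 1 else 0)"
      using linear_independent_extend[OF indep, of "\<lambda>x. if inv_into I g x = j then 1 else 0"] by blast
    have "g i \<bullet> adjoint h 1 = (if i = j then 1 else 0)" if "i \<in> I" for i
      using h that inj by (simp add: adjoint_works)
    then show ?thesis
      by blast
  qed
  then obtain E where E: "\<And>i j. i \<in> I \<Longrightarrow> g i \<bullet> E j = (if i = j then 1 else 0)"
    by metis
  have "card (g ` I) = DIM('e)"
    using card_image[OF inj] card by simp
  then have span: "span (g ` I) = UNIV"
    using card_ge_dim_independent[of "g ` I" UNIV] indep by auto
  have "e = (\<Sum>i\<in>I. (g i \<bullet> e) *\<^sub>R E i)" for e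
  proof -
    let ?d = "e - (\<Sum>i\<in>I. (g i \<bullet> e) *\<^sub>R E i)"
    have "orthogonal ?d (g j)" if "j \<in> I" for j
    proof -
      have "g j \<bullet> (\<Sum>i\<in>I. (g i \<bullet> e) *\<^sub>R E i) = (\<Sum>i\<in>I. if i = j then g j \<bullet> e else 0)"
        unfolding inner_sum_right by (rule sum.cong) (use E that in auto)
      also have "\<dots> = g j \<bullet> e"
        using that fin by simp
      finally show ?thesis
        unfolding orthogonal_def inner_commute[of ?d] inner_diff_right by simp
    qed
    then have "orthogonal ?d ?d"
      using orthogonal_to_span[of ?d "g ` I" ?d] span by auto
    then show ?thesis
      by (simp add: orthogonal_def)
  qed
  with E that show ?thesis
    by blast
qed

lemma poly_eq_0_if_many_roots:
  fixes p :: "real poly"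
  assumes "finite R" "\<And>s. s \<in> R \<Longrightarrow> poly p s = 0" "degree p < card R"
  shows "p = 0"
proof (rule ccontr)
  assume "p \<noteq> 0"
  then have "card R \<le> card {s. poly p s = 0}"
    using assms by (intro card_mono poly_roots_finite) auto
  also have "\<dots> \<le> degree p"
    using \<open>p \<noteq> 0\<close> by (rule card_poly_roots_bound)
  finally show False
    using assms(3) by simp
qed

text \<open>Vanishing of the coefficient of degree \<open>N\<close> says that \<open>\<infinity>\<close> is a root of \<open>p\<close>, seen as a form of
  degree \<open>N\<close> on the projective line.\<close>
lemma poly_eq_0_if_many_rp1_roots:
  fixes p :: "real poly" and a :: "nat \<Rightarrow> rp1"
  assumes inj: "inj_on a {0..N}" and deg: "degree p \<le> N"
    and fin: "\<And>m s. m \<in> {0..N} \<Longrightarrow> a m = Fin s \<Longrightarrow> poly p s = 0"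
    and inf: "\<And>m. m \<in> {0..N} \<Longrightarrow> a m = Infty \<Longrightarrow> coeff p N = 0"
  shows "p = 0"
proof -
  define R where "R = Fin -` a ` {0..N}"
  have finR: "finite R"
    unfolding R_def by (rule finite_vimageI) (auto simp: inj_def)
  have card: "card (a ` {0..N}) = N + 1"
    using card_image[OF inj] by simp
  have roots: "poly p s = 0" if "s \<in> R" for s
  proof -
    have "Fin s \<in> a ` {0..N}"
      using that by (simp add: R_def)
    then obtain m where m: "Fin s = a m" "m \<in> {0..N}"
      by (rule imageE)
    show ?thesis
      by (rule fin[OF m(2) m(1)[symmetric]])
  qed
  have sub: "a ` {0..N} \<subseteq> insert Infty (Fin ` R)"
  proof
    fix t assume "t \<in> a ` {0..N}"
    then show "t \<in> insert Infty (Fin ` R)"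
      by (cases t) (auto simp: R_def)
  qed
  show ?thesis
  proof (cases "Infty \<in> a ` {0..N}")
    case True
    then obtain m where "m \<in> {0..N}" "a m = Infty"
      by (metis imageE)
    then have "coeff p N = 0"
      by (rule inf)
    have "N + 1 \<le> card (insert Infty (Fin ` R))"
      unfolding card[symmetric] using finR sub by (intro card_mono) auto
    also have "\<dots> \<le> Suc (card R)"
      using finR by (metis card_image_le card_insert_le_m1 card_insert_if finite_imageI le_SucI Suc_le_mono)
    finally have "N \<le> card R"
      by simp
    show ?thesis
    proof (rule ccontr)
      assume "p \<noteq> 0"
      then have "degree p \<noteq> N"
        using \<open>coeff p N = 0\<close> leading_coeff_0_iff by blast
      with deg \<open>N \<le> card R\<close> have "degree p < card R"
        by simp
      with finR roots have "p = 0"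
        by (rule poly_eq_0_if_many_roots)
      with \<open>p \<noteq> 0\<close> show False ..
    qed
  next
    case False
    have "a ` {0..N} \<subseteq> Fin ` R"
      using sub unfolding subset_insert[OF False] .
    then have "N + 1 \<le> card (Fin ` R)"
      unfolding card[symmetric] using finR by (intro card_mono finite_imageI)
    also have "\<dots> \<le> card R"
      using finR by (rule card_image_le)
    finally have "degree p < card R"
      using deg by simp
    with finR roots show ?thesis
      by (rule poly_eq_0_if_many_roots)
  qed
qed

text \<open>Given a basis \<open>E\<close> dual to the coframe, these vectors span the common kernel of the forms with
  parameter \<open>t\<close>. What matters is that they are polynomial in \<open>t\<close> of degree only 1: this keeps the
  degree in \<open>veronese_vanishing\<close> down to \<open>n + 2\<close>.\<close>
definition kernel_gen :: "(nat \<times> nat \<Rightarrow> 'e::real_vector) \<Rightarrow> rp1 \<Rightarrow> nat \<times> nat \<Rightarrow> 'e" where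
  "kernel_gen E t p = (case t of Fin s \<Rightarrow> s *\<^sub>R E p - E (fst p, Suc (snd p)) | Infty \<Rightarrow> E p)"

lemma kernel_gen_annihilated:
  fixes g :: "nat \<Rightarrow> nat \<Rightarrow> 'e::euclidean_space"
  assumes dual: "\<And>p q. p \<in> I \<Longrightarrow> q \<in> I \<Longrightarrow> (case p of (i, j) \<Rightarrow> g i j) \<bullet> E q = (if p = q then 1 else 0)"
    and I: "I = {1..k} \<times> {0..n}" and p: "p \<in> {1..k} \<times> {0..<n}" and l: "l \<in> {1..k}"
  shows "veronese_form n g t l \<bullet> kernel_gen E t p = 0"
proof -
  obtain i j where ij: "p = (i, j)" "i \<in> {1..k}" "j < n"
    using p by auto
  have d: "g l m \<bullet> E (i, j') = (if l = i \<and> m = j' then 1 else 0)" if "m \<in> {0..n}" "j' \<le> n" for m j'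
    using dual[of "(l, m)" "(i, j')"] that l ij by (simp add: I)
  show ?thesis
  proof (cases t)
    case (Fin s)
    have "veronese_form n g t l \<bullet> E (i, j') = (if l = i then s ^ j' else 0)" if "j' \<le> n" for j'
    proof -
      have "veronese_form n g t l \<bullet> E (i, j') = (\<Sum>m=0..n. if m = j' then (if l = i then s ^ j' else 0) else 0)"
        unfolding veronese_form_def Fin rp1.case inner_sum_left
        by (rule sum.cong) (use d that in auto)
      then show ?thesis
        using that by (simp add: sum.delta)
    qed
    with ij show ?thesis
      by (simp add: kernel_gen_def Fin inner_diff_right)
  next
    case Infty
    then show ?thesis
      using d[of n j] ij by (simp add: kernel_gen_def veronese_form_def)
  qed
qed

text \<open>For finite \<open>s\<close>, each \<open>E (i, j) - s ^ j *\<^sub>R E (i, 0)\<close> is a combination of the generators, by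
  induction on \<open>j\<close>. The basis expansion of a vector of the kernel is a combination of these, since the
  coefficients of \<open>E (i, 0)\<close> that have to be added sum up to the value of the \<open>i\<close>-th form, which is 0.\<close>
lemma kernel_subset_span:
  fixes g :: "nat \<Rightarrow> nat \<Rightarrow> 'e::euclidean_space"
  assumes expand: "\<And>e. e = (\<Sum>p\<in>{1..k} \<times> {0..n}. ((case p of (i, j) \<Rightarrow> g i j) \<bullet> e) *\<^sub>R E p)"
    and u: "\<And>l. l \<in> {1..k} \<Longrightarrow> veronese_form n g t l \<bullet> u = 0"
  shows "u \<in> span (kernel_gen E t ` ({1..k} \<times> {0..<n}))" (is "u \<in> span ?G")
proof (cases t)
  case Infty
  have "(\<Sum>p\<in>{1..k} \<times> {0..n}. ((case p of (i, j) \<Rightarrow> g i j) \<bullet> u) *\<^sub>R E p) \<in> span ?G"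
  proof (rule span_sum)
    fix p assume "p \<in> {1..k} \<times> {0..n}"
    then obtain i j where p: "p = (i, j)" "i \<in> {1..k}" "j \<le> n"
      by auto
    show "((case p of (i, j) \<Rightarrow> g i j) \<bullet> u) *\<^sub>R E p \<in> span ?G"
    proof (cases "j = n")
      case True
      then show ?thesis
        using u[of i] p Infty by (simp add: veronese_form_def span_zero)
    next
      case False
      then have "kernel_gen E t p \<in> ?G"
        using p by auto
      then show ?thesis
        by (intro span_scale span_base) (simp add: kernel_gen_def Infty)
    qed
  qed
  then show ?thesis
    using expand[of u] by simp
next
  case (Fin s)
  have diff: "E (i, j) - s ^ j *\<^sub>R E (i, 0) \<in> span ?G" if "i \<in> {1..k}" "j \<le> n" for i j
    using that(2)
  proof (induction j)
    case 0
    then show ?case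
      by (simp add: span_zero)
  next
    case (Suc j)
    have "kernel_gen E t (i, j) \<in> span ?G"
      by (rule span_base) (use Suc that in auto)
    then have "s *\<^sub>R (E (i, j) - s ^ j *\<^sub>R E (i, 0)) - kernel_gen E t (i, j) \<in> span ?G"
      using Suc by (intro span_diff[OF span_scale]) auto
    moreover have "s *\<^sub>R (E (i, j) - s ^ j *\<^sub>R E (i, 0)) - kernel_gen E t (i, j) =
        E (i, Suc j) - s ^ Suc j *\<^sub>R E (i, 0)"
      by (simp add: kernel_gen_def Fin scaleR_diff_right)
    ultimately show ?case
      by (simp only:)
  qed
  have "(\<Sum>p\<in>{1..k} \<times> {0..n}. ((case p of (i, j) \<Rightarrow> g i j) \<bullet> u) *\<^sub>R (s ^ snd p *\<^sub>R E (fst p, 0)))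
      = (\<Sum>i=1..k. (\<Sum>j=0..n. s ^ j * (g i j \<bullet> u)) *\<^sub>R E (i, 0))"
    unfolding scaleR_sum_left sum.cartesian_product
    by (rule sum.cong) (auto simp: mult.commute)
  also have "\<dots> = 0"
    using u by (intro sum.neutral ballI) (simp add: veronese_form_def Fin inner_sum_left)
  finally have "u = (\<Sum>p\<in>{1..k} \<times> {0..n}. ((case p of (i, j) \<Rightarrow> g i j) \<bullet> u) *\<^sub>R
      (E p - s ^ snd p *\<^sub>R E (fst p, 0)))"
    using expand[of u] by (simp add: scaleR_diff_right sum_subtractf)
  also have "\<dots> \<in> span ?G"
    by (intro span_sum span_scale) (use diff in auto)
  finally show ?thesis .
qed

lemma bilinear_diff_left_right:
  fixes B :: "'e::real_vector \<Rightarrow> 'e \<Rightarrow> real"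
  assumes "bilinear B"
  shows "B (s *\<^sub>R x - x') (s *\<^sub>R y - y') = s\<^sup>2 * B x y - s * (B x y' + B x' y) + B x' y'"
  using assms
  by (simp add: bilinear_lsub bilinear_rsub bilinear_lmul bilinear_rmul algebra_simps power2_eq_square)

lemma bilinear_veronese_form:
  fixes B :: "nat \<Rightarrow> nat \<Rightarrow> 'e::real_vector \<Rightarrow> 'e \<Rightarrow> real"
  assumes "\<And>j. j \<in> {0..n} \<Longrightarrow> bilinear (B i j)"
  shows "bilinear (\<lambda>u v. veronese_form n (\<lambda>i j. B i j u v) t i)"
  using assms
  by (cases t)
     (auto simp: bilinear_def veronese_form_def linear_iff sum.distrib sum_distrib_left algebra_simps)

text \<open>The algebraic core. On two of the generators of \<open>kernel_gen\<close>, each of degree at most 1 in the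
  parameter, the bilinear form, of degree \<open>n\<close>, becomes a polynomial of degree at most \<open>n + 2\<close>. Its
  coefficient of degree \<open>n + 2\<close> is the corresponding value at \<open>\<infinity>\<close>, so the \<open>n + 3\<close> points of the
  projective line at which it vanishes force it to be zero. The generators span the kernels, so
  bilinearity carries the conclusion over to all vectors of the kernel.\<close>
lemma veronese_vanishing:
  fixes g :: "nat \<Rightarrow> nat \<Rightarrow> 'e::euclidean_space" and B :: "nat \<Rightarrow> nat \<Rightarrow> 'e \<Rightarrow> 'e \<Rightarrow> real"
  assumes ind: "independent_family ({1..k} \<times> {0..n}) (\<lambda>(i, j). g i j)" and dim: "DIM('e) = k * (n + 1)"
    and bil: "\<And>i j. i \<in> {1..k} \<Longrightarrow> j \<in> {0..n} \<Longrightarrow> bilinear (B i j)"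
    and a: "inj_on a {0..n + 2}"
    and van: "\<And>m i u v. m \<in> {0..n + 2} \<Longrightarrow> i \<in> {1..k} \<Longrightarrow>
      (\<And>l. l \<in> {1..k} \<Longrightarrow> veronese_form n g (a m) l \<bullet> u = 0) \<Longrightarrow>
      (\<And>l. l \<in> {1..k} \<Longrightarrow> veronese_form n g (a m) l \<bullet> v = 0) \<Longrightarrow>
      veronese_form n (\<lambda>i j. B i j u v) (a m) i = 0"
    and i: "i \<in> {1..k}"
    and u: "\<And>l. l \<in> {1..k} \<Longrightarrow> veronese_form n g t l \<bullet> u = 0"
    and v: "\<And>l. l \<in> {1..k} \<Longrightarrow> veronese_form n g t l \<bullet> v = 0"
  shows "veronese_form n (\<lambda>i j. B i j u v) t i = 0"
proof -
  let ?I = "{1..k} \<times> {0..n}" and ?J = "{1..k} \<times> {0..<n}"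
  obtain E where dual: "\<And>p q. p \<in> ?I \<Longrightarrow> q \<in> ?I \<Longrightarrow>
      (case p of (i, j) \<Rightarrow> g i j) \<bullet> E q = (if p = q then 1 else 0)"
    and expand: "\<And>e. e = (\<Sum>p\<in>?I. ((case p of (i, j) \<Rightarrow> g i j) \<bullet> e) *\<^sub>R E p)"
    by (rule dual_basis[OF _ ind]) (use dim in auto)
  have gens: "veronese_form n (\<lambda>i j. B i j (kernel_gen E t p) (kernel_gen E t q)) t i = 0"
    if p: "p \<in> ?J" and q: "q \<in> ?J" for p q t
  proof -
    define p' q' where "p' = (fst p, Suc (snd p))" and "q' = (fst q, Suc (snd q))"
    \<comment> \<open>The value on \<open>p\<close> and \<open>q\<close> of the form with parameter \<open>s\<close>, expanded in powers of \<open>s\<close>: the index \<open>m\<close>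
      comes from the form, the three inner coefficients from the two generators.\<close>
    define P where "P = (\<Sum>m=0..n. monom 1 m *
      [:B i m (E p') (E q'), - (B i m (E p) (E q') + B i m (E p') (E q)), B i m (E p) (E q):])"
    have Fin: "poly P s = veronese_form n (\<lambda>i j. B i j (kernel_gen E (Fin s) p) (kernel_gen E (Fin s) q)) (Fin s) i" for s
      unfolding P_def poly_sum veronese_form_def rp1.case kernel_gen_def p'_def[symmetric] q'_def[symmetric]
      by (rule sum.cong)
         (simp_all add: bilinear_diff_left_right[OF bil[OF i]] poly_monom algebra_simps power2_eq_square)
    have coeff: "coeff P N = (\<Sum>m=0..n. if N < m then 0 else
        coeff [:B i m (E p') (E q'), - (B i m (E p) (E q') + B i m (E p') (E q)), B i m (E p) (E q):] (N - m))" for N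
      unfolding P_def coeff_sum by (rule sum.cong[OF refl]) (simp only: coeff_monom_mult mult_1)
    have "coeff P (n + 2) = (\<Sum>m=0..n. if m = n then B i n (E p) (E q) else 0)"
      unfolding coeff by (rule sum.cong) (auto simp: coeff_pCons numeral_2_eq_2 split: nat.split)
    then have Infty: "coeff P (n + 2) = veronese_form n (\<lambda>i j. B i j (kernel_gen E Infty p) (kernel_gen E Infty q)) Infty i"
      by (simp add: veronese_form_def kernel_gen_def)
    have "degree P \<le> n + 2"
      by (intro degree_le allI impI) (auto simp: coeff coeff_pCons split: nat.split intro!: sum.neutral)
    moreover have "veronese_form n (\<lambda>i j. B i j (kernel_gen E (a m) p) (kernel_gen E (a m) q)) (a m) i = 0"
      if "m \<in> {0..n + 2}" for m
      by (rule van[OF that i]) (rule kernel_gen_annihilated[OF dual refl], use p q in auto)+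
    ultimately have "P = 0"
      using a Fin Infty by (intro poly_eq_0_if_many_rp1_roots[of a "n + 2" P]) metis+
    then show ?thesis
      using Fin Infty by (cases t) auto
  qed
  have "veronese_form n (\<lambda>i j. B i j u v) t i = (\<lambda>u v. 0 :: real) u v"
  proof (rule bilinear_eq[where f = "\<lambda>u v. veronese_form n (\<lambda>i j. B i j u v) t i",
        OF _ _ order_refl order_refl])
    show "bilinear (\<lambda>u v. veronese_form n (\<lambda>i j. B i j u v) t i)"
      by (rule bilinear_veronese_form) (rule bil[OF i])
    show "u \<in> span (kernel_gen E t ` ?J)" "v \<in> span (kernel_gen E t ` ?J)"
      using kernel_subset_span[OF expand] u v by blast+
  qed (use gens in \<open>auto simp: bilinear_def linear_zero\<close>)
  then show ?thesis .
qed

section \<open>Distributions and their sections\<close>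

text \<open>Independence of covectors and of tangent vectors is transported into the model space by this lemma,
  since the coordinate maps are linear on all functions but injective only on the (co)tangent space.\<close>
lemma independent_family_image:
  assumes "independent_family I f" "linear L" "inj_on L S" "span (f ` I) \<subseteq> S"
  shows "independent_family I (\<lambda>i. L (f i))"
proof -
  have inj: "inj_on L (span (f ` I))"
    using assms(3,4) by (rule inj_on_subset)
  have "inj_on L (f ` I)"
    using inj span_superset by (rule inj_on_subset)
  then have "inj_on (L \<circ> f) I"
    using assms(1) by (intro comp_inj_on) (auto simp: independent_family_def)
  moreover have "independent (L ` f ` I)"
    using assms(1) by (intro linear_independent_injective_image[OF assms(2) _ inj])
      (simp add: independent_family_def)
  ultimately show ?thesis
    by (simp add: independent_family_def image_image comp_def)
qed

lemma dim_span_independent_family: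
  assumes "independent_family I f"
  shows "dim (span (f ` I)) = card I"
  using assms by (simp add: independent_family_def dim_span dim_eq_card_independent card_image)

lemma subspace_cotangent_space: "subspace (cotangent_space A p)"
  by (rule subspaceI) (auto simp: cotangent_space_def plus_fun_def zero_fun_def scaleR_fun_def algebra_simps)

lemma veronese_form_in_subspace:
  assumes "subspace S" "\<And>j. j \<in> {0..n} \<Longrightarrow> g i j \<in> S"
  shows "veronese_form n g t i \<in> S"
  using assms by (cases t) (auto simp: veronese_form_def intro!: subspace_sum subspace_scale)

lemma has_derivative_veronese_form:
  assumes "\<And>j. j \<in> {0..n} \<Longrightarrow> \<theta> i j differentiable at x"
  shows "((\<lambda>x. veronese_form n (\<lambda>i j. \<theta> i j x) t i) has_derivative
    (\<lambda>u. veronese_form n (\<lambda>i j. frechet_derivative (\<theta> i j) (at x) u) t i)) (at x)"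
  using assms unfolding frechet_derivative_works
  by (cases t) (auto simp: veronese_form_def intro!: has_derivative_sum has_derivative_scaleR_right)

lemma ext_deriv_veronese_form:
  assumes "\<And>j. j \<in> {0..n} \<Longrightarrow> \<theta> i j differentiable at x"
  shows "ext_deriv (\<lambda>x. veronese_form n (\<lambda>i j. \<theta> i j x) t i) x u v =
    veronese_form n (\<lambda>i j. ext_deriv (\<theta> i j) x u v) t i"
proof -
  have D: "frechet_derivative (\<lambda>x. veronese_form n (\<lambda>i j. \<theta> i j x) t i) (at x) u =
      veronese_form n (\<lambda>i j. frechet_derivative (\<theta> i j) (at x) u) t i" for u
    by (rule fun_cong[OF frechet_derivative_at[symmetric]], rule has_derivative_veronese_form, rule assms)
  have inner: "veronese_form n h t i \<bullet> v = veronese_form n (\<lambda>i j. h i j \<bullet> v) t i"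
    for h :: "nat \<Rightarrow> nat \<Rightarrow> 'a" and v
    by (rule linear_veronese_form[of "\<lambda>e. e \<bullet> v"]) (auto intro: bounded_linear.linear bounded_linear_inner_left)
  show ?thesis
    unfolding ext_deriv_def D inner
    by (cases t) (simp_all add: veronese_form_def sum_subtractf right_diff_distrib)
qed

lemma bilinear_ext_deriv:
  assumes "\<theta> differentiable at x"
  shows "bilinear (ext_deriv \<theta> x)"
proof -
  interpret linear "frechet_derivative \<theta> (at x)"
    using assms unfolding frechet_derivative_works by (rule has_derivative_linear)
  show ?thesis
    unfolding bilinear_def
    by (auto intro!: linearI simp: ext_deriv_def add scale inner_add_left inner_add_right right_diff_distrib)
qed

lemma analytic_one_form_subset:
  "analytic_one_form A U \<omega> \<Longrightarrow> V \<subseteq> U \<Longrightarrow> analytic_one_form A V \<omega>"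
  unfolding analytic_one_form_def
  by (meson Int_mono image_mono order_refl real_analytic_subset subsetD)

lemma analytic_vector_field_subset:
  "analytic_vector_field A U Y \<Longrightarrow> V \<subseteq> U \<Longrightarrow> analytic_vector_field A V Y"
  unfolding analytic_vector_field_def
  by (meson Int_mono image_mono order_refl real_analytic_subset subsetD)

context atlas
begin

lemma chart_at:
  assumes "p \<in> topspace X"
  obtains c where "c \<in> A" "p \<in> fst c"
  using assms manifold unfolding analytic_manifold_def by blast

lemma section_on_0:
  assumes "U \<subseteq> topspace X" "\<And>q. q \<in> U \<Longrightarrow> subspace (D q)"
  shows "section_on A U D (\<lambda>q. 0)"
proof -
  have "0 \<in> tangent_space A q" if "q \<in> U" for q
    using chart_at[of q] subspace_tangent_space subspace_0 that assms(1) by (metis subsetD)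
  moreover have "real_analytic_on (vector_field_in_chart c (\<lambda>q. 0)) S" for c :: "('m, 'e) chart" and S
    unfolding vector_field_in_chart_def zero_fun_def by (rule real_analytic_const)
  ultimately show ?thesis
    using assms(2) by (auto simp: section_on_def analytic_vector_field_def subspace_0)
qed

lemma section_on_add:
  assumes "U \<subseteq> topspace X" "\<And>q. q \<in> U \<Longrightarrow> subspace (D q)" "section_on A U D Y" "section_on A U D Z"
  shows "section_on A U D (\<lambda>q. Y q + Z q)"
proof -
  have "Y q + Z q \<in> tangent_space A q" if q: "q \<in> U" for q
  proof -
    obtain c where "c \<in> A" "q \<in> fst c"
      using chart_at q assms(1) by blast
    from subspace_add[OF subspace_tangent_space[OF this]] q assms(3,4) show ?thesis
      by (simp add: section_on_def analytic_vector_field_def)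
  qed
  moreover have "real_analytic_on (vector_field_in_chart c (\<lambda>q. Y q + Z q)) (snd c ` (U \<inter> fst c))"
    if "c \<in> A" for c
    unfolding vector_field_in_chart_def plus_fun_def
    by (rule real_analytic_add)
       (use assms(3,4) that in \<open>auto simp: section_on_def analytic_vector_field_def vector_field_in_chart_def\<close>)
  ultimately show ?thesis
    using assms(2-4) by (auto simp: section_on_def analytic_vector_field_def subspace_add)
qed

lemma section_on_scale:
  assumes "U \<subseteq> topspace X" "\<And>q. q \<in> U \<Longrightarrow> subspace (D q)" "section_on A U D Y"
  shows "section_on A U D (\<lambda>q. r *\<^sub>R Y q)"
proof -
  have "r *\<^sub>R Y q \<in> tangent_space A q" if q: "q \<in> U" for q
  proof -
    obtain c where "c \<in> A" "q \<in> fst c"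
      using chart_at q assms(1) by blast
    from subspace_scale[OF subspace_tangent_space[OF this]] q assms(3) show ?thesis
      by (simp add: section_on_def analytic_vector_field_def)
  qed
  moreover have "real_analytic_on (vector_field_in_chart c (\<lambda>q. r *\<^sub>R Y q)) (snd c ` (U \<inter> fst c))"
    if "c \<in> A" for c
    unfolding vector_field_in_chart_def scaleR_fun_def
    by (rule real_analytic_bounded_linear[OF bounded_linear_scaleR_right])
       (use assms(3) that in \<open>auto simp: section_on_def analytic_vector_field_def vector_field_in_chart_def\<close>)
  ultimately show ?thesis
    using assms(2,3) by (auto simp: section_on_def analytic_vector_field_def subspace_scale)
qed

text \<open>The sections through the vectors of \<open>D p\<close> are the constant linear combinations of a local frame. A
  single neighbourhood serves all vectors, so that two sections can be bracketed.\<close>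
lemma analytic_distribution_section_through:
  assumes D: "analytic_distribution X A r D" and p: "p \<in> topspace X"
  obtains U where "openin X U" "p \<in> U" "\<And>v. v \<in> D p \<Longrightarrow> \<exists>Y. section_on A U D Y \<and> Y p = v"
proof -
  obtain U F where *: "openin X U \<and> p \<in> U \<and> (\<forall>i\<in>{1..r}. analytic_vector_field A U (F i)) \<and>
      (\<forall>q\<in>U. basis_family {1..r} (\<lambda>i. F i q) (D q))"
    using bspec[OF D[unfolded analytic_distribution_def] p] by (elim exE)
  then have U: "openin X U" "p \<in> U" and F: "\<And>i. i \<in> {1..r} \<Longrightarrow> analytic_vector_field A U (F i)"
    and basis: "\<And>q. q \<in> U \<Longrightarrow> basis_family {1..r} (\<lambda>i. F i q) (D q)"
    by simp_all
  have span: "D q = span ((\<lambda>i. F i q) ` {1..r})" if "q \<in> U" for q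
    using basis[OF that] by (simp add: basis_family_def)
  have sub: "U \<subseteq> topspace X" "\<And>q. q \<in> U \<Longrightarrow> subspace (D q)"
    using openin_subset[OF U(1)] span by auto
  define V where "V = {v. \<exists>Y. section_on A U D Y \<and> Y p = v}"
  have "subspace V"
  proof (rule subspaceI)
    show "0 \<in> V"
      using section_on_0[of U D, OF sub] unfolding V_def by blast
    show "u + v \<in> V" if "u \<in> V" "v \<in> V" for u v
      using that section_on_add[of U D, OF sub] unfolding V_def by blast
    show "r *\<^sub>R v \<in> V" if "v \<in> V" for r v
      using that section_on_scale[of U D, OF sub] unfolding V_def by blast
  qed
  moreover have "section_on A U D (F i)" if "i \<in> {1..r}" for i
    using F[OF that] that span by (auto simp: section_on_def intro!: span_base)
  then have "(\<lambda>i. F i p) ` {1..r} \<subseteq> V"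
    unfolding V_def by blast
  ultimately have "D p \<subseteq> V"
    unfolding span[OF U(2)] by (intro span_minimal)
  with U that show ?thesis
    unfolding V_def by blast
qed

lemma analytic_distribution_basis_at:
  assumes D: "analytic_distribution X A r D" and p: "p \<in> topspace X"
  obtains f where "basis_family {1..r} f (D p)" "D p \<subseteq> tangent_space A p"
proof -
  obtain U F where *: "openin X U \<and> p \<in> U \<and> (\<forall>i\<in>{1..r}. analytic_vector_field A U (F i)) \<and>
      (\<forall>q\<in>U. basis_family {1..r} (\<lambda>i. F i q) (D q))"
    using bspec[OF D[unfolded analytic_distribution_def] p] by (elim exE)
  then have U: "p \<in> U" and F: "\<And>i. i \<in> {1..r} \<Longrightarrow> analytic_vector_field A U (F i)"
    and basis: "basis_family {1..r} (\<lambda>i. F i p) (D p)"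
    by simp_all
  obtain c where c: "c \<in> A" "p \<in> fst c"
    using chart_at[OF p] .
  have "(\<lambda>i. F i p) ` {1..r} \<subseteq> tangent_space A p"
    using F U by (auto simp: analytic_vector_field_def)
  then have "span ((\<lambda>i. F i p) ` {1..r}) \<subseteq> tangent_space A p"
    by (rule span_minimal[OF _ subspace_tangent_space[OF c]])
  with basis that show ?thesis
    by (simp add: basis_family_def)
qed

text \<open>The distribution lies in the kernel by assumption; in a chart both are subspaces of the model space
  of dimension \<open>r\<close>, the kernel because it is the orthogonal complement of \<open>k\<close> independent vectors.\<close>
lemma distribution_eq_common_kernel:
  assumes D: "analytic_distribution X A r D" and p: "p \<in> topspace X"
    and f: "independent_family {1..k} f" "\<And>l. l \<in> {1..k} \<Longrightarrow> f l \<in> cotangent_space A p"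
    and ann: "\<And>l v. l \<in> {1..k} \<Longrightarrow> v \<in> D p \<Longrightarrow> f l v = 0"
    and dim: "DIM('e) = k + r"
  shows "D p = {v \<in> tangent_space A p. \<forall>l\<in>{1..k}. f l v = 0}"
proof -
  obtain c where c: "c \<in> A" "p \<in> fst c"
    using chart_at[OF p] .
  obtain b where b: "basis_family {1..r} b (D p)" and DT: "D p \<subseteq> tangent_space A p"
    using analytic_distribution_basis_at[OF D p] .
  define \<kappa> where "\<kappa> = covector_coords A c p"
  define \<pi> where "\<pi> = (\<lambda>v :: ('m, 'e) tvec. v c)"
  have \<pi>: "linear \<pi>"
    by (rule linearI) (simp_all add: \<pi>_def plus_fun_def scaleR_fun_def)
  have \<pi>_inj: "inj_on \<pi> (tangent_space A p)"
    using tangent_vector_eqI[OF _ _ c] by (auto simp: \<pi>_def inj_on_def)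
  have D_span: "D p = span (b ` {1..r})"
    using b by (simp add: basis_family_def)
  have pair: "\<omega> v = \<kappa> \<omega> \<bullet> \<pi> v" if "\<omega> \<in> cotangent_space A p" "v \<in> tangent_space A p" for \<omega> v
    using covector_apply[OF c that] by (simp add: \<kappa>_def \<pi>_def)
  define F where "F = span ((\<lambda>l. \<kappa> (f l)) ` {1..k})"
  define K where "K = {y \<in> UNIV. \<forall>x\<in>F. orthogonal x y}"
  have "span (f ` {1..k}) \<subseteq> cotangent_space A p"
    by (rule span_minimal[OF _ subspace_cotangent_space]) (use f in auto)
  then have "independent_family {1..k} (\<lambda>l. \<kappa> (f l))"
    unfolding \<kappa>_def by (rule independent_family_image[OF f(1) linear_covector_coords covector_coords_inj_on[OF c]])
  from dim_span_independent_family[OF this] have "dim F = k"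
    unfolding F_def by simp
  then have dimK: "dim K = r"
    using dim_subspace_orthogonal_to_vectors[of F UNIV] dim by (simp add: F_def K_def)
  have "independent_family {1..r} (\<lambda>i. \<pi> (b i))"
    by (rule independent_family_image[OF _ \<pi> \<pi>_inj]) (use b DT in \<open>simp_all add: basis_family_def\<close>)
  from dim_span_independent_family[OF this] have dimD: "dim (\<pi> ` D p) = r"
    unfolding D_span linear_span_image[OF \<pi>, symmetric] image_image by simp
  have "subspace (\<pi> ` D p)"
    unfolding D_span by (intro linear_subspace_image[OF \<pi>] subspace_span)
  moreover have "subspace K"
    unfolding K_def using subspace_orthogonal_to_vectors[of F] by (simp add: orthogonal_commute)
  moreover have K_iff: "\<pi> v \<in> K \<longleftrightarrow> (\<forall>l\<in>{1..k}. f l v = 0)" if v: "v \<in> tangent_space A p" for v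
  proof
    assume "\<pi> v \<in> K"
    then show "\<forall>l\<in>{1..k}. f l v = 0"
      using pair[OF f(2) v] by (auto simp: K_def F_def orthogonal_def intro: span_base)
  next
    assume *: "\<forall>l\<in>{1..k}. f l v = 0"
    have "orthogonal (\<pi> v) (\<kappa> (f l))" if "l \<in> {1..k}" for l
      using * that pair[OF f(2)[OF that] v] by (simp add: orthogonal_def inner_commute)
    then have "orthogonal (\<pi> v) x" if "x \<in> F" for x
      using that unfolding F_def by (elim orthogonal_to_span) blast
    then show "\<pi> v \<in> K"
      by (simp add: K_def orthogonal_commute)
  qed
  moreover have "\<pi> ` D p \<subseteq> K"
    using K_iff DT ann by auto
  ultimately have eq: "\<pi> ` D p = K"
    using dimK dimD by (intro subspace_dim_equal) auto
  show ?thesis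
  proof (intro equalityI subsetI)
    fix v assume "v \<in> {v \<in> tangent_space A p. \<forall>l\<in>{1..k}. f l v = 0}"
    then have v: "v \<in> tangent_space A p" "\<pi> v \<in> \<pi> ` D p"
      using K_iff eq by auto
    then obtain u where u: "u \<in> D p" "\<pi> v = \<pi> u"
      by blast
    with \<pi>_inj v(1) DT have "v = u"
      by (auto simp: inj_on_def)
    with u show "v \<in> D p"
      by simp
  qed (use DT ann in auto)
qed

end

section \<open>Integrability of Veronese curves\<close>

context atlas
begin

lemma form_in_chart_veronese:
  "form_in_chart c (\<lambda>q. veronese_form n (\<lambda>i j. \<gamma> i j q) t i) =
    (\<lambda>x. veronese_form n (\<lambda>i j. form_in_chart c (\<gamma> i j) x) t i)"
  unfolding form_in_chart_def by (rule ext) (rule linear_veronese_form[OF linear_covector_coords])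

lemma veronese_form_lie_bracket:
  assumes \<gamma>: "\<And>j. j \<in> {0..n} \<Longrightarrow> analytic_one_form A V (\<gamma> i j)"
    and V: "openin X V" "p \<in> V" and c: "c \<in> A" "p \<in> fst c"
    and Y: "analytic_vector_field A V Y" and Z: "analytic_vector_field A V Z"
    and 0: "\<And>q. q \<in> V \<Longrightarrow> veronese_form n (\<lambda>i j. \<gamma> i j q) t i (Y q) = 0"
      "\<And>q. q \<in> V \<Longrightarrow> veronese_form n (\<lambda>i j. \<gamma> i j q) t i (Z q) = 0"
  shows "veronese_form n (\<lambda>i j. \<gamma> i j p) t i (lie_bracket A Y Z p) =
    - veronese_form n (\<lambda>i j. ext_deriv (form_in_chart c (\<gamma> i j)) (snd c p) (Y p c) (Z p c)) t i"
proof -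
  have diff: "form_in_chart c (\<gamma> i j) differentiable at (snd c p)" if "j \<in> {0..n}" for j
    by (rule real_analytic_differentiable[OF real_analytic_form_in_chart[OF \<gamma>[OF that] c(1)]])
       (use V c in auto)
  have ext: "ext_deriv (\<lambda>x. veronese_form n (\<lambda>i j. form_in_chart c (\<gamma> i j) x) t i) (snd c p) u v =
      veronese_form n (\<lambda>i j. ext_deriv (form_in_chart c (\<gamma> i j)) (snd c p) u v) t i" for u v
    by (rule ext_deriv_veronese_form) (rule diff)
  show ?thesis
    unfolding ext[symmetric] form_in_chart_veronese[symmetric]
  proof (rule form_lie_bracket[OF Y Z _ _ V c 0])
    show "veronese_form n (\<lambda>i j. \<gamma> i j q) t i \<in> cotangent_space A q" if "q \<in> V" for q
      by (rule veronese_form_in_subspace[OF subspace_cotangent_space])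
         (use \<gamma> that in \<open>auto simp: analytic_one_form_def\<close>)
    show "form_in_chart c (\<lambda>q. veronese_form n (\<lambda>i j. \<gamma> i j q) t i) differentiable at (snd c p)"
      unfolding form_in_chart_veronese
      by (rule differentiableI, rule has_derivative_veronese_form, rule diff)
  qed
qed

text \<open>In the proof, the \<open>B i j\<close> are the exterior derivatives of the coframe at the point \<open>p\<close>. By Cartan's formula
  integrability at \<open>a m\<close> makes the combination of the \<open>B i j\<close> at that parameter vanish on the vectors
  of \<open>w (a m) p\<close>, because these extend to sections. Then it vanishes on \<open>w t p\<close> for every \<open>t\<close>, and
  Cartan's formula, read backwards, shows that the forms with parameter \<open>t\<close> annihilate brackets of
  sections of \<open>w t\<close>.\<close>
lemma lie_bracket_in_veronese_distribution:
  assumes dim: "DIM('e) = k * (n + 1)" and curve: "generalized_veronese_curve X A k n w"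
    and a: "inj_on a {0..n + 2}"
    and int: "\<And>m. m \<in> {0..n + 2} \<Longrightarrow> integrable_distribution X A (w (a m))"
    and V: "openin X V" "p \<in> V" and Y: "section_on A V (w t) Y" and Z: "section_on A V (w t) Z"
  shows "lie_bracket A Y Z p \<in> w t p"
proof -
  have p: "p \<in> topspace X"
    using openin_subset V by blast
  obtain c where c: "c \<in> A" "p \<in> fst c"
    using chart_at[OF p] .
  have dist: "analytic_distribution X A (k * n) (w t)" for t
    using curve by (simp add: generalized_veronese_curve_def)
  have "\<forall>p\<in>topspace X. \<exists>U \<gamma>. openin X U \<and> p \<in> U \<and>
        (\<forall>i\<in>{1..k}. \<forall>j\<in>{0..n}. analytic_one_form A U (\<gamma> i j)) \<and>
        (\<forall>q\<in>U. basis_family ({1..k} \<times> {0..n}) (\<lambda>(i, j). \<gamma> i j q) (cotangent_space A q)) \<and>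
        (\<forall>q\<in>U. \<forall>t.
           independent_family {1..k} (veronese_form n (\<lambda>i j. \<gamma> i j q) t) \<and>
           (\<forall>i\<in>{1..k}. \<forall>v\<in>w t q. veronese_form n (\<lambda>i j. \<gamma> i j q) t i v = 0))"
    by (rule conjunct2[OF curve[unfolded generalized_veronese_curve_def]])
  from bspec[OF this p] obtain U \<gamma> where *: "openin X U \<and> p \<in> U \<and>
        (\<forall>i\<in>{1..k}. \<forall>j\<in>{0..n}. analytic_one_form A U (\<gamma> i j)) \<and>
        (\<forall>q\<in>U. basis_family ({1..k} \<times> {0..n}) (\<lambda>(i, j). \<gamma> i j q) (cotangent_space A q)) \<and>
        (\<forall>q\<in>U. \<forall>t.
           independent_family {1..k} (veronese_form n (\<lambda>i j. \<gamma> i j q) t) \<and>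
           (\<forall>i\<in>{1..k}. \<forall>v\<in>w t q. veronese_form n (\<lambda>i j. \<gamma> i j q) t i v = 0))"
    by (elim exE)
  then have U: "openin X U" "p \<in> U"
    and \<gamma>: "\<And>i j. i \<in> {1..k} \<Longrightarrow> j \<in> {0..n} \<Longrightarrow> analytic_one_form A U (\<gamma> i j)"
    and basis: "basis_family ({1..k} \<times> {0..n}) (\<lambda>(i, j). \<gamma> i j p) (cotangent_space A p)"
    and ind: "\<And>t. independent_family {1..k} (veronese_form n (\<lambda>i j. \<gamma> i j p) t)"
    and ann: "\<And>q t i v. q \<in> U \<Longrightarrow> i \<in> {1..k} \<Longrightarrow> v \<in> w t q \<Longrightarrow>
      veronese_form n (\<lambda>i j. \<gamma> i j q) t i v = 0"
    by simp_all
  define g where "g i j = covector_coords A c p (\<gamma> i j p)" for i j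
  define B where "B i j = ext_deriv (form_in_chart c (\<gamma> i j)) (snd c p)" for i j
  define \<alpha> where "\<alpha> t i = veronese_form n (\<lambda>i j. \<gamma> i j p) t i" for t i
  have \<gamma>p: "\<gamma> i j p \<in> cotangent_space A p" if "i \<in> {1..k}" "j \<in> {0..n}" for i j
    using \<gamma>[OF that] U(2) by (simp add: analytic_one_form_def)
  have \<alpha>_cot: "\<alpha> t i \<in> cotangent_space A p" if "i \<in> {1..k}" for t i
    unfolding \<alpha>_def
    by (rule veronese_form_in_subspace[OF subspace_cotangent_space]) (rule \<gamma>p[OF that])
  have \<alpha>_g: "\<alpha> t i v = veronese_form n g t i \<bullet> v c" if "i \<in> {1..k}" "v \<in> tangent_space A p" for t i v
    unfolding covector_apply[OF c \<alpha>_cot[OF that(1)] that(2)]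
    unfolding \<alpha>_def g_def linear_veronese_form[OF linear_covector_coords] ..
  have w_eq: "w t p = {v \<in> tangent_space A p. \<forall>l\<in>{1..k}. \<alpha> t l v = 0}" for t
    by (rule distribution_eq_common_kernel[OF dist p])
       (use ind \<alpha>_cot ann[OF U(2)] dim in \<open>auto simp: \<alpha>_def[abs_def]\<close>)
  have bracket: "\<alpha> t i (lie_bracket A Y Z p) = - veronese_form n (\<lambda>i j. B i j (Y p c) (Z p c)) t i"
    if W: "openin X W" "p \<in> W" and Y: "section_on A W (w t) Y" and Z: "section_on A W (w t) Z"
      and i: "i \<in> {1..k}" for W Y Z t i
    unfolding \<alpha>_def B_def
  proof (rule veronese_form_lie_bracket[where V = "U \<inter> W"])
    show "analytic_one_form A (U \<inter> W) (\<gamma> i j)" if "j \<in> {0..n}" for j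
      by (rule analytic_one_form_subset[OF \<gamma>[OF i that]]) simp
    show "analytic_vector_field A (U \<inter> W) Y" "analytic_vector_field A (U \<inter> W) Z"
      using Y Z analytic_vector_field_subset[of A W _ "U \<inter> W"] by (auto simp: section_on_def)
  qed (use U W c ann i Y Z in \<open>auto simp: section_on_def\<close>)
  have bil: "bilinear (B i j)" if "i \<in> {1..k}" "j \<in> {0..n}" for i j
    unfolding B_def
    by (rule bilinear_ext_deriv, rule real_analytic_differentiable, rule real_analytic_form_in_chart[OF \<gamma>[OF that] c(1)])
       (use U c in auto)
  have van: "veronese_form n (\<lambda>i j. B i j u v) (a m) i = 0"
    if m: "m \<in> {0..n + 2}" and i: "i \<in> {1..k}"
      and u: "\<And>l. l \<in> {1..k} \<Longrightarrow> veronese_form n g (a m) l \<bullet> u = 0"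
      and v: "\<And>l. l \<in> {1..k} \<Longrightarrow> veronese_form n g (a m) l \<bullet> v = 0" for m i u v
  proof -
    have lift: "coord_vector A c p e \<in> w (a m) p"
      if "\<And>l. l \<in> {1..k} \<Longrightarrow> veronese_form n g (a m) l \<bullet> e = 0" for e
      unfolding w_eq using that \<alpha>_g coord_vector_in_tangent_space[OF c]
      by (simp add: coord_vector_own_chart[OF c])
    obtain W where W: "openin X W" "p \<in> W"
      and sec: "\<And>v. v \<in> w (a m) p \<Longrightarrow> \<exists>Y. section_on A W (w (a m)) Y \<and> Y p = v"
      using analytic_distribution_section_through[OF dist p, of "a m"] by blast
    obtain Y where Y: "section_on A W (w (a m)) Y" "Y p = coord_vector A c p u"
      using sec[OF lift[OF u]] by blast
    obtain Z where Z: "section_on A W (w (a m)) Z" "Z p = coord_vector A c p v"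
      using sec[OF lift[OF v]] by blast
    have "section_on A W (w (a m)) (lie_bracket A Y Z)"
      using int[OF m] W(1) Y(1) Z(1) unfolding integrable_distribution_def by blast
    then have "lie_bracket A Y Z p \<in> w (a m) p"
      using W(2) by (simp add: section_on_def)
    then have "\<alpha> (a m) i (lie_bracket A Y Z p) = 0"
      using i unfolding w_eq by blast
    then show ?thesis
      using bracket[OF W Y(1) Z(1) i] by (simp add: Y(2) Z(2) coord_vector_own_chart[OF c])
  qed
  have g: "independent_family ({1..k} \<times> {0..n}) (\<lambda>(i, j). g i j)"
  proof -
    have "(\<lambda>(i, j). g i j) = (\<lambda>x. covector_coords A c p ((\<lambda>(i, j). \<gamma> i j p) x))"
      by (auto simp: fun_eq_iff g_def)
    moreover have "independent_family ({1..k} \<times> {0..n})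
        (\<lambda>x. covector_coords A c p ((\<lambda>(i, j). \<gamma> i j p) x))"
      by (rule independent_family_image[OF _ linear_covector_coords covector_coords_inj_on[OF c]])
         (use basis in \<open>simp_all add: basis_family_def\<close>)
    ultimately show ?thesis
      by (simp only:)
  qed
  have tangent: "Y p \<in> tangent_space A p" "Z p \<in> tangent_space A p" "Y p \<in> w t p" "Z p \<in> w t p"
    using Y Z V by (auto simp: section_on_def analytic_vector_field_def)
  have "\<alpha> t i (lie_bracket A Y Z p) = 0" if i: "i \<in> {1..k}" for i
  proof -
    have "veronese_form n g t l \<bullet> Y p c = 0" "veronese_form n g t l \<bullet> Z p c = 0" if "l \<in> {1..k}" for l
      using tangent(3,4) that unfolding \<alpha>_g[OF that tangent(1), symmetric] \<alpha>_g[OF that tangent(2), symmetric]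
        w_eq by blast+
    then have "veronese_form n (\<lambda>i j. B i j (Y p c) (Z p c)) t i = 0"
      by (intro veronese_vanishing[OF g dim bil a van i])
    then show ?thesis
      using bracket[OF V Y Z i] by simp
  qed
  moreover have "lie_bracket A Y Z p \<in> tangent_space A p"
    using Y Z V by (intro lie_bracket_tangent[of V]) (auto simp: section_on_def)
  ultimately show ?thesis
    unfolding w_eq by blast
qed

end

theorem theorem2:
  fixes X :: "'m topology" and A :: "('m, 'e::euclidean_space) chart set"
    and k n :: nat and w :: "rp1 \<Rightarrow> 'm \<Rightarrow> ('m, 'e) tvec set" and a :: "nat \<Rightarrow> rp1"
  assumes "k \<ge> 1"
    and "analytic_manifold X A" and "DIM('e) = k * (n + 1)"
    and "generalized_veronese_curve X A k n w"
    and "inj_on a {0..n + 2}"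
    and "\<And>m. m \<in> {0..n + 2} \<Longrightarrow> integrable_distribution X A (w (a m))"
  shows "generalized_veronese_web X A k n w"
proof -
  interpret atlas X A
    using assms(2) by (rule atlas.intro)
  have "section_on A U (w t) (lie_bracket A Y Z)"
    if "openin X U" "section_on A U (w t) Y" "section_on A U (w t) Z" for t U Y Z
    using that lie_bracket_in_veronese_distribution[OF assms(3-6)]
      analytic_lie_bracket[of U Y Z] unfolding section_on_def by blast
  then show ?thesis
    using assms(4) by (simp add: generalized_veronese_web_def integrable_distribution_def)
qed

end
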